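(* Let $\mathfrak{X}$ be a complete class of finite groups. For finite groups $G_1$ and $G_2$, the relation $G_1\underset{\mathfrak{X}}{\equiv}G_2$ holds if and only if the complete reductions over $\mathfrak{X}$ of $G_1$ and $G_2$ are isomorphic. The relation $\underset{\mathfrak{X}}{\equiv}$ is an equivalence relation on finite groups. Each equivalence class contains a group completely reduced over $\mathfrak{X}$, unique up to isomorphism, and this group is a universally attracting object in this class, regarded as a subcategory of the category of all finite groups and $\mathfrak{X}$-isoschematisms.
   Context: All groups are finite. A class of groups is closed under isomorphism. A nonempty class $\mathfrak{X}$ of finite groups is called complete if it is closed under taking subgroups, homomorphic images and extensions; the last means that $G\in\mathfrak{X}$ whenever $G$ has a normal subgroup $N$ with $N\in\mathfrak{X}$ and $G/N\in\mathfrak{X}$. An $\mathfrak{X}$-maximal subgroup of $G$ is a subgroup of $G$ that is maximal by inclusion among the subgroups of $G$ belonging to $\mathfrak{X}$. $\mathrm{k}_{\mathfrak{X}}(G)$ denotes the number of $G$-conjugacy classes of $\mathfrak{X}$-maximal subgroups of $G$. An $\mathfrak{X}$-scheme of $G$ is a complete system of representatives of the conjugacy classes of $\mathfrak{X}$-maximal subgroups of $G$ (one subgroup from each class). An epimorphism $\phi:G\to G^*$ is called an $\mathfrak{X}$-isoschematism if it carries an $\mathfrak{X}$-scheme of $G$ (any one or, equivalently, some one) to an $\mathfrak{X}$-scheme of $G^*$, as systems of representatives: if $H_1,\dots,H_k$ is an $\mathfrak{X}$-scheme of $G$ listed without repetition, then $\phi(H_1),\dots,\phi(H_k)$ is an $\mathfrak{X}$-scheme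 of $G^*$ listed without repetition. One writes $G_1\underset{\mathfrak{X}}{\equiv}G_2$ if there are a finite group $G_0$ and $\mathfrak{X}$-isoschematisms $G_1\to G_0$ and $G_2\to G_0$. For a finite group $G$ put $R=\langle N\mid N\trianglelefteq G\text{ and }\mathrm{k}_{\mathfrak{X}}(G)=\mathrm{k}_{\mathfrak{X}}(G/N)\rangle$. The quotient $G/R$ is called the complete reduction of $G$ over $\mathfrak{X}$, and $R$ is called the kernel of this reduction. The group $G$ is called completely reduced over $\mathfrak{X}$ if this kernel $R$ is trivial. In the category of finite groups and $\mathfrak{X}$-isoschematisms, morphisms are considered up to composition with automorphisms of the groups. An object is universally attracting if every object of the category has exactly one morphism to it; here this means: every group in the equivalence class has an $\mathfrak{X}$-isoschematism onto the given group, and it is unique up to composition with automorphisms of the groups. *)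

theory Defs
  imports "HOL-Algebra.Algebra"
begin

definition finite_group :: "('a, 'b) monoid_scheme \<Rightarrow> bool" where
  "finite_group G \<longleftrightarrow> group G \<and> finite (carrier G)"

(* A class of finite groups, closed under isomorphism, is given by its members with carrier
   a set of natural numbers: every finite group is isomorphic to one of this kind. *)
definition group_class :: "nat monoid set \<Rightarrow> bool" where
  "group_class \<XX> \<longleftrightarrow>
     (\<forall>K\<in>\<XX>. finite_group K) \<and>
     (\<forall>K\<in>\<XX>. \<forall>L :: nat monoid. group L \<and> K \<cong> L \<longrightarrow> L \<in> \<XX>)"

(* Membership in the class for groups over an arbitrary type, e.g. quotients. *)
definition in_class :: "nat monoid set \<Rightarrow> ('a, 'b) monoid_scheme \<Rightarrow> bool" where
  "in_class \<XX> G \<longleftrightarrow> (\<exists>K\<in>\<XX>. G \<cong> K)"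

definition complete_class :: "nat monoid set \<Rightarrow> bool" where
  "complete_class \<XX> \<longleftrightarrow>
     group_class \<XX> \<and> \<XX> \<noteq> {} \<and>
     (\<forall>G\<in>\<XX>. \<forall>H. subgroup H G \<longrightarrow> in_class \<XX> (G\<lparr>carrier := H\<rparr>)) \<and>
     (\<forall>G\<in>\<XX>. \<forall>L :: nat monoid. group L \<and> epi G L \<noteq> {} \<longrightarrow> in_class \<XX> L) \<and>
     (\<forall>G :: nat monoid. \<forall>N. finite_group G \<and> N \<lhd> G \<and>
        in_class \<XX> (G\<lparr>carrier := N\<rparr>) \<and> in_class \<XX> (G Mod N) \<longrightarrow> in_class \<XX> G)"

definition X_maximals :: "nat monoid set \<Rightarrow> ('a, 'b) monoid_scheme \<Rightarrow> 'a set set" where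
  "X_maximals \<XX> G =
     {H. subgroup H G \<and> in_class \<XX> (G\<lparr>carrier := H\<rparr>) \<and>
         (\<forall>K. subgroup K G \<and> in_class \<XX> (G\<lparr>carrier := K\<rparr>) \<and> H \<subseteq> K \<longrightarrow> K = H)}"

definition conjugate_sets :: "('a, 'b) monoid_scheme \<Rightarrow> 'a set \<Rightarrow> 'a set \<Rightarrow> bool" where
  "conjugate_sets G H K \<longleftrightarrow> (\<exists>g\<in>carrier G. K = g <#\<^bsub>G\<^esub> H #>\<^bsub>G\<^esub> inv\<^bsub>G\<^esub> g)"

definition X_conj_classes :: "nat monoid set \<Rightarrow> ('a, 'b) monoid_scheme \<Rightarrow> 'a set set set" where
  "X_conj_classes \<XX> G =
     X_maximals \<XX> G //
       {(H, K). H \<in> X_maximals \<XX> G \<and> K \<in> X_maximals \<XX> G \<and> conjugate_sets G H K}"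

definition k_X :: "nat monoid set \<Rightarrow> ('a, 'b) monoid_scheme \<Rightarrow> nat" where
  "k_X \<XX> G = card (X_conj_classes \<XX> G)"

definition X_scheme :: "nat monoid set \<Rightarrow> ('a, 'b) monoid_scheme \<Rightarrow> 'a set set \<Rightarrow> bool" where
  "X_scheme \<XX> G S \<longleftrightarrow> S \<subseteq> X_maximals \<XX> G \<and> (\<forall>C\<in>X_conj_classes \<XX> G. \<exists>!H. H \<in> S \<and> H \<in> C)"

(* Injectivity on the scheme expresses that the images are listed without repetition. *)
definition isoschematism ::
    "nat monoid set \<Rightarrow> ('a, 'c) monoid_scheme \<Rightarrow> ('b, 'd) monoid_scheme \<Rightarrow> ('a \<Rightarrow> 'b) \<Rightarrow> bool" where
  "isoschematism \<XX> G G' \<phi> \<longleftrightarrow>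
     finite_group G \<and> finite_group G' \<and> \<phi> \<in> epi G G' \<and>
     (\<exists>S. X_scheme \<XX> G S \<and> inj_on (\<lambda>H. \<phi> ` H) S \<and> X_scheme \<XX> G' ((\<lambda>H. \<phi> ` H) ` S))"

definition X_equiv :: "nat monoid set \<Rightarrow> ('a, 'c) monoid_scheme \<Rightarrow> ('b, 'd) monoid_scheme \<Rightarrow> bool" where
  "X_equiv \<XX> G\<^sub>1 G\<^sub>2 \<longleftrightarrow>
     (\<exists>G\<^sub>0 :: nat monoid. finite_group G\<^sub>0 \<and>
        (\<exists>\<phi>\<^sub>1. isoschematism \<XX> G\<^sub>1 G\<^sub>0 \<phi>\<^sub>1) \<and> (\<exists>\<phi>\<^sub>2. isoschematism \<XX> G\<^sub>2 G\<^sub>0 \<phi>\<^sub>2))"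

definition X_equiv_rel :: "nat monoid set \<Rightarrow> ('a monoid \<times> 'a monoid) set" where
  "X_equiv_rel \<XX> = {(G\<^sub>1, G\<^sub>2). finite_group G\<^sub>1 \<and> finite_group G\<^sub>2 \<and> X_equiv \<XX> G\<^sub>1 G\<^sub>2}"

definition reduction_kernel :: "nat monoid set \<Rightarrow> ('a, 'b) monoid_scheme \<Rightarrow> 'a set" where
  "reduction_kernel \<XX> G = generate G (\<Union>{N. N \<lhd> G \<and> k_X \<XX> G = k_X \<XX> (G Mod N)})"

definition complete_reduction :: "nat monoid set \<Rightarrow> ('a, 'b) monoid_scheme \<Rightarrow> 'a set monoid" where
  "complete_reduction \<XX> G = G Mod reduction_kernel \<XX> G"

definition completely_reduced :: "nat monoid set \<Rightarrow> ('a, 'b) monoid_scheme \<Rightarrow> bool" where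
  "completely_reduced \<XX> G \<longleftrightarrow> reduction_kernel \<XX> G = {\<one>\<^bsub>G\<^esub>}"

(* Two homomorphisms represent the same morphism when they differ by automorphisms of
   source and target; values outside the carrier of G are irrelevant. *)
definition same_morphism ::
    "('a, 'c) monoid_scheme \<Rightarrow> ('b, 'd) monoid_scheme \<Rightarrow> ('a \<Rightarrow> 'b) \<Rightarrow> ('a \<Rightarrow> 'b) \<Rightarrow> bool" where
  "same_morphism G G' \<phi> \<psi> \<longleftrightarrow>
     (\<exists>\<alpha>\<in>iso G G. \<exists>\<beta>\<in>iso G' G'. \<forall>x\<in>carrier G. \<psi> x = \<beta> (\<phi> (\<alpha> x)))"

(* The full subcategory of finite groups and isoschematisms is given by its objects E. *)
definition universally_attracting :: "nat monoid set \<Rightarrow> 'a monoid set \<Rightarrow> 'a monoid \<Rightarrow> bool" where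
  "universally_attracting \<XX> E C \<longleftrightarrow>
     C \<in> E \<and>
     (\<forall>G\<in>E. \<exists>\<phi>. isoschematism \<XX> G C \<phi> \<and>
        (\<forall>\<psi>. isoschematism \<XX> G C \<psi> \<longrightarrow> same_morphism G C \<phi> \<psi>))"

end

theory Submission
  imports Defs
begin

text \<open>
  Call a normal subgroup \<open>N\<close> of \<open>G\<close> reducing if \<open>A \<subseteq> N B\<close> forces \<open>A\<close> and \<open>B\<close> to be
  conjugate, for all \<open>\<XX>\<close>-maximal subgroups \<open>A\<close>, \<open>B\<close>. Every statement about isoschematisms and
  about the numbers \<open>k_X\<close> is a statement about reducing subgroups: an epimorphism is an
  isoschematism exactly when its kernel is reducing (\<open>isoschematism_iff_reducing\<close>), and for an
  epimorphism from \<open>G\<close> onto \<open>H\<close> this amounts to \<open>k_X \<XX> G = k_X \<XX> H\<close>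
  (\<open>k_X_eq_iff_isoschematism\<close>). So the reduction kernel is generated by the reducing subgroups.

  The heart of the matter is that the product of two reducing subgroups \<open>N\<close>, \<open>M\<close> is reducing
  (\<open>reducing_set_mult\<close>); the reduction kernel \<open>R\<close> is then itself reducing and is the greatest such
  subgroup. The proof is elementary. Let \<open>\<pi>(\<XX>)\<close> be the
  set of primes that divide the order of a member of the class. If \<open>M\<close> is reducing, then the index
  of \<open>M \<inter> K\<close> in \<open>M\<close> is prime to \<open>\<pi>(\<XX>)\<close> for every \<open>\<XX>\<close>-maximal \<open>K\<close>: by the Frattini argument some \<open>\<XX>\<close>-maximal subgroup
  with the same image modulo \<open>M\<close> as \<open>K\<close> contains a given Sylow subgroup of \<open>M\<close>, and it is conjugate
  to \<open>K\<close> (\<open>reducing_hall\<close>). Now let \<open>H \<subseteq> N M K\<close> with \<open>H\<close>, \<open>K\<close> maximal and put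
  \<open>D = K \<inter> N M H\<close>. Modulo \<open>N \<inter> M\<close> the subgroup \<open>N D \<inter> M H\<close> is a subdirect product of the images
  of \<open>D\<close> and \<open>H\<close>, hence in the class, and it lifts to an \<open>\<XX>\<close>-subgroup, contained in a maximal \<open>L\<close>.
  As \<open>H \<subseteq> M L\<close>, the subgroups \<open>L\<close> and \<open>H\<close> are conjugate. The index of \<open>N D\<close> in \<open>N L\<close>
  is a \<open>\<pi>(\<XX>)\<close>-number because \<open>L\<close> lies in the class, and is prime to \<open>\<pi>(\<XX>)\<close> because \<open>D\<close>
  contains \<open>M \<inter> K\<close>. Hence \<open>L \<subseteq> N D \<subseteq> N K\<close>, and \<open>L\<close> is conjugate to \<open>K\<close> as well.

  Throughout one needs that an \<open>\<XX>\<close>-subgroup of an epimorphic image is the image of an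
  \<open>\<XX>\<close>-subgroup (\<open>X_subgroup_lift\<close>). Induction and the Frattini argument reduce this to an
  extension of an \<open>\<XX>\<close>-group by an abelian \<open>p\<close>-group; either the extension is in the class, or the
  order of the quotient is prime to \<open>p\<close> and the extension splits.

  The rest is formal. Composing isoschematisms shows that an isoschematism onto \<open>C\<close> has kernel
  \<open>R\<close> exactly when \<open>C\<close> is completely reduced (\<open>completely_reduced_iff_kernel\<close>). Consequently an
  isoschematism does not change the complete reduction, equivalence is isomorphism of complete
  reductions, and two isoschematisms onto the same completely reduced group have the same kernel and
  so differ by an automorphism of the target.
\<close>

section \<open>Homomorphisms, quotients and isomorphic copies\<close>

lemma epi_iff_group_hom:
  assumes "group G" "group H"
  shows "\<phi> \<in> epi G H \<longleftrightarrow> group_hom G H \<phi> \<and> \<phi> ` carrier G = carrier H"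
  using assms by (auto simp: epi_def group_hom_def group_hom_axioms_def)

lemma normal_projection:
  assumes "N \<lhd> G"
  shows "group_hom G (G Mod N) (\<lambda>x. N #>\<^bsub>G\<^esub> x)"
    and "(\<lambda>x. N #>\<^bsub>G\<^esub> x) ` carrier G = carrier (G Mod N)"
    and "kernel G (G Mod N) (\<lambda>x. N #>\<^bsub>G\<^esub> x) = N"
proof -
  interpret N: normal N G by fact
  show "group_hom G (G Mod N) (\<lambda>x. N #>\<^bsub>G\<^esub> x)"
    by (simp add: group_hom_def group_hom_axioms_def N.is_group N.factorgroup_is_group N.r_coset_hom_Mod)
  show "(\<lambda>x. N #>\<^bsub>G\<^esub> x) ` carrier G = carrier (G Mod N)"
    by (simp add: carrier_FactGroup)
  have "N #>\<^bsub>G\<^esub> x = N \<longleftrightarrow> x \<in> N" if "x \<in> carrier G" for x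
    using that N.coset_join1[OF _ that N.subgroup_axioms] N.coset_join2[OF that N.subgroup_axioms] N.subset
    by blast
  then show "kernel G (G Mod N) (\<lambda>x. N #>\<^bsub>G\<^esub> x) = N"
    using N.subset by (auto simp: kernel_def)
qed

lemma (in group_hom) eq_iff_kernel:
  assumes "x \<in> carrier G" "y \<in> carrier G"
  shows "h x = h y \<longleftrightarrow> x \<otimes> inv y \<in> kernel G H h"
proof -
  have "h x \<otimes>\<^bsub>H\<^esub> inv\<^bsub>H\<^esub> h y = \<one>\<^bsub>H\<^esub> \<longleftrightarrow> h x = h y"
    using assms H.inv_solve_right'[of "\<one>\<^bsub>H\<^esub>" "h x" "h y"] by auto
  then show ?thesis
    using assms by (simp add: kernel_def)
qed

text \<open>
  The factorization avoids quotient groups, so that it can be applied when \<open>L\<close> is any image of \<open>G\<close>.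
\<close>
lemma epi_factor:
  assumes p: "group_hom G L p" and surj: "p ` carrier G = carrier L"
    and f: "group_hom G Q f" and ker: "kernel G L p \<subseteq> kernel G Q f"
  obtains g where "group_hom L Q g" "\<And>x. x \<in> carrier G \<Longrightarrow> g (p x) = f x"
proof -
  interpret p: group_hom G L p by fact
  interpret f: group_hom G Q f by fact
  define g where "g y = f (SOME x. x \<in> carrier G \<and> p x = y)" for y
  have g: "g (p x) = f x" if x: "x \<in> carrier G" for x
  proof -
    let ?y = "SOME y. y \<in> carrier G \<and> p y = p x"
    have "?y \<in> carrier G \<and> p ?y = p x"
      by (rule someI[of _ x]) (simp add: x)
    then show ?thesis
      unfolding g_def using p.eq_iff_kernel[of ?y x] f.eq_iff_kernel[of ?y x] x ker by blast
  qed
  have "group_hom L Q g"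
  proof (intro group_hom.intro group_hom_axioms.intro homI p.H.is_group f.H.is_group)
    fix x y assume "x \<in> carrier L" "y \<in> carrier L"
    then obtain a b where ab: "a \<in> carrier G" "b \<in> carrier G" "x = p a" "y = p b"
      using surj by blast
    then show "g x \<in> carrier Q"
      using g by simp
    have "g (x \<otimes>\<^bsub>L\<^esub> y) = g (p (a \<otimes>\<^bsub>G\<^esub> b))"
      using ab by simp
    also have "\<dots> = g x \<otimes>\<^bsub>Q\<^esub> g y"
      using ab g by (simp del: p.hom_mult)
    finally show "g (x \<otimes>\<^bsub>L\<^esub> y) = g x \<otimes>\<^bsub>Q\<^esub> g y" .
  qed
  then show ?thesis using g that by blast
qed

text \<open>
  A complete class consists of groups on natural numbers, and the members of an equivalence class
  live on one fixed type. Quotient groups, whose elements are cosets, enter both through copies.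
\<close>
lemma isomorphic_copy:
  fixes f :: "'a \<Rightarrow> 'c"
  assumes G: "group G" and inj: "inj_on f (carrier G)"
  obtains L :: "'c monoid" where "group L" "f \<in> iso G L"
proof -
  interpret group G by fact
  let ?i = "inv_into (carrier G) f"
  let ?L = "\<lparr>carrier = f ` carrier G, monoid.mult = (\<lambda>x y. f (?i x \<otimes>\<^bsub>G\<^esub> ?i y)), one = f \<one>\<^bsub>G\<^esub>\<rparr> :: 'c monoid"
  have hom: "f \<in> hom G ?L"
    using inj by (auto simp: hom_def)
  have "group ?L"
    using hom_imp_img_group[OF hom] by simp
  moreover have "f \<in> iso G ?L"
    using hom inj by (simp add: iso_def bij_betw_def)
  ultimately show ?thesis using that by blast
qed

lemma nat_copy:
  assumes "finite_group G"
  obtains L :: "nat monoid" and f where "finite_group L" "f \<in> iso G L"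
proof -
  have "group G" "finite (carrier G)"
    using assms by (auto simp: finite_group_def)
  moreover obtain f :: "'a \<Rightarrow> nat" where "inj_on f (carrier G)"
    using finite_imp_inj_to_nat_seg[OF \<open>finite (carrier G)\<close>] by blast
  ultimately obtain L :: "nat monoid" where "group L" "f \<in> iso G L"
    using isomorphic_copy by blast
  then have "finite_group L"
    using \<open>finite (carrier G)\<close> iso_finite[of G L] by (auto simp: finite_group_def is_iso_def)
  with \<open>f \<in> iso G L\<close> show ?thesis using that by blast
qed

lemma epi_card:
  assumes "group_hom G H f" "f ` carrier G = carrier H"
  shows "card (carrier G) = card (carrier H) * card (kernel G H f)"
proof -
  interpret group_hom G H f by fact
  have "card (rcosets\<^bsub>G\<^esub> (kernel G H f)) = card (carrier H)"
    using iso_same_card[OF FactGroup_iso[OF assms(2)]] by (simp add: FactGroup_def)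
  then show ?thesis
    using G.lagrange[OF subgroup_kernel] by (simp add: order_def)
qed

lemma quotient_nat_copy:
  assumes fin: "finite_group G" and N: "N \<lhd> G"
  obtains L :: "nat monoid" and q where "group_hom G L q" "q ` carrier G = carrier L" "kernel G L q = N"
proof -
  have "finite_group (G Mod N)"
    using fin normal.factorgroup_is_group[OF N] by (simp add: finite_group_def carrier_FactGroup)
  then obtain L :: "nat monoid" and h where L: "finite_group L" and h: "h \<in> iso (G Mod N) L"
    by (rule nat_copy)
  have gL: "group L" and gG: "group G" and gQ: "group (G Mod N)"
    using L fin \<open>finite_group (G Mod N)\<close> by (auto simp: finite_group_def)
  let ?p = "\<lambda>x. N #>\<^bsub>G\<^esub> x"
  have p: "?p \<in> epi G (G Mod N)"
    using normal_projection(1,2)[OF N] epi_iff_group_hom[OF gG gQ] by blast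
  then have "h \<circ> ?p \<in> epi G L"
    using h by (meson epi_compose iso_iff_mon_epi)
  then have "group_hom G L (h \<circ> ?p)" "(h \<circ> ?p) ` carrier G = carrier L"
    using epi_iff_group_hom[OF gG gL] by blast+
  moreover have "kernel G L (h \<circ> ?p) = N"
  proof -
    have "kernel (G Mod N) L h = {N}"
      using iso_kernel_image[OF gQ gL] h by simp
    then have "kernel G L (h \<circ> ?p) = kernel G (G Mod N) ?p"
      using p by (auto simp: kernel_def epi_def)
    then show ?thesis
      using normal_projection(3)[OF N] by simp
  qed
  ultimately show ?thesis using that by blast
qed

lemma (in group_hom) subgroup_preimage:
  assumes K: "subgroup K H"
  shows "subgroup {x \<in> carrier G. h x \<in> K} G"
  using subgroup.one_closed[OF K] subgroup.m_closed[OF K] subgroup.m_inv_closed[OF K]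
  by (intro G.subgroupI) auto

section \<open>Actions of p-groups\<close>

text \<open>
  The orbits have \<open>p\<close>-power size, and those of size one are the fixed points. This one congruence
  yields both the conjugacy of Sylow subgroups and the nontrivial centre of a \<open>p\<close>-group.
\<close>
lemma (in group_action) card_fixed_points_mod:
  fixes p :: nat
  assumes p: "Factorial_Ring.prime p" and ord: "order G = p ^ n" and fin: "finite E"
  shows "card {x \<in> E. \<forall>g\<in>carrier G. \<phi> g x = x} mod p = card E mod p"
proof -
  let ?F = "{x \<in> E. \<forall>g\<in>carrier G. \<phi> g x = x}"
  let ?O = "orbits G E \<phi>"
  let ?S = "(\<lambda>x. {x}) ` ?F"
  have finO: "finite ?O"
    by (simp add: orbits_def fin)
  have G: "group G"
    using group_hom by (simp add: group_hom_def)
  have one: "\<one>\<^bsub>G\<^esub> \<in> carrier G"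
    using G by (simp add: group_def)
  have SO: "?S \<subseteq> ?O"
  proof clarify
    fix x assume x: "x \<in> E" "\<forall>g\<in>carrier G. \<phi> g x = x"
    then have "orbit G \<phi> x \<subseteq> {x}"
      by (auto simp: orbit_def)
    then have "orbit G \<phi> x = {x}"
      using orbit_refl[OF x(1)] by blast
    then show "{x} \<in> ?O"
      using x unfolding orbits_def by blast
  qed
  have dvd: "p dvd card Y" if Y: "Y \<in> ?O - ?S" for Y
  proof -
    obtain x where x: "x \<in> E" "Y = orbit G \<phi> x"
      using Y by (auto simp: orbits_def)
    have "card Y dvd p ^ n"
      using orbit_stabilizer_theorem[OF x(1)] x(2) ord by (metis dvd_triv_left)
    then obtain k where k: "card Y = p ^ k"
      using p divides_primepow_nat by blast
    have xX: "x \<in> Y"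
      using orbit_refl x by blast
    have "card Y \<noteq> 1"
    proof
      assume "card Y = 1"
      then have "Y = {x}"
        using xX by (metis card_1_singletonE singletonD)
      then have "\<forall>g\<in>carrier G. \<phi> g x = x"
        using x(2) by (auto simp: orbit_def)
      then show False
        using Y x(1) \<open>Y = {x}\<close> by auto
    qed
    then show ?thesis
      using k by (cases k) auto
  qed
  have "card E = (\<Sum>Y\<in>?O. card Y)"
    using disjoint_sum[OF fin, of "\<lambda>_. 1 :: nat"] by simp
  also have "\<dots> = (\<Sum>Y\<in>?S. card Y) + (\<Sum>Y\<in>?O - ?S. card Y)"
    using sum.subset_diff[OF SO finO] by (simp add: add.commute)
  also have "(\<Sum>Y\<in>?S. card Y) = card ?F"
    by (subst sum.reindex) (auto simp: inj_on_def)
  finally have "card E = card ?F + (\<Sum>Y\<in>?O - ?S. card Y)" .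
  moreover have "p dvd (\<Sum>Y\<in>?O - ?S. card Y)"
    by (rule dvd_sum) (rule dvd)
  ultimately show ?thesis
    by (auto elim!: dvdE)
qed

lemma (in group) group_action_restrict:
  assumes closed: "\<And>g x. g \<in> carrier G \<Longrightarrow> x \<in> E \<Longrightarrow> f g x \<in> E"
    and one: "\<And>x. x \<in> E \<Longrightarrow> f \<one> x = x"
    and mult: "\<And>g h x. g \<in> carrier G \<Longrightarrow> h \<in> carrier G \<Longrightarrow> x \<in> E \<Longrightarrow> f (g \<otimes> h) x = f g (f h x)"
  shows "group_action G E (\<lambda>g. restrict (f g) E)"
proof -
  have bij: "restrict (f g) E \<in> Bij E" if g: "g \<in> carrier G" for g
  proof -
    have "bij_betw (f g) E E"
    proof (rule bij_betwI[where g = "f (inv g)"])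
      show "f (inv g) (f g x) = x" "f g (f (inv g) x) = x" if "x \<in> E" for x
        using mult[of "inv g" g x] mult[of g "inv g" x] that g one by auto
    qed (use closed g in auto)
    then show ?thesis
      by (simp add: Bij_def cong: bij_betw_cong)
  qed
  have "(\<lambda>g. restrict (f g) E) \<in> hom G (BijGroup E)"
  proof (rule homI)
    show "restrict (f g) E \<in> carrier (BijGroup E)" if "g \<in> carrier G" for g
      using bij[OF that] by (simp add: BijGroup_def)
    show "restrict (f (g \<otimes> h)) E = restrict (f g) E \<otimes>\<^bsub>BijGroup E\<^esub> restrict (f h) E"
      if "g \<in> carrier G" "h \<in> carrier G" for g h
      using bij[OF that(1)] bij[OF that(2)] mult[OF that] closed[OF that(2)]
      by (simp add: BijGroup_def compose_def restrict_def fun_eq_iff)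
  qed
  then show ?thesis
    by (simp add: group_action_def group_hom_def group_hom_axioms_def group_BijGroup)
qed

lemma (in group) p_group_center_nontrivial:
  fixes p :: nat
  assumes p: "Factorial_Ring.prime p" and ord: "order G = p ^ n" and n: "n > 0"
  shows "\<exists>z\<in>carrier G. z \<noteq> \<one> \<and> (\<forall>g\<in>carrier G. g \<otimes> z = z \<otimes> g)"
proof -
  have fin: "finite (carrier G)"
    using ord p order_gt_0_iff_finite by (metis prime_gt_0_nat zero_less_power)
  let ?f = "\<lambda>g. \<lambda>h \<in> carrier G. g \<otimes> h \<otimes> inv g"
  interpret A: group_action G "carrier G" ?f
    by (rule action_by_conjugation)
  let ?F = "{x \<in> carrier G. \<forall>g\<in>carrier G. ?f g x = x}"
  have "card ?F mod p = card (carrier G) mod p"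
    by (rule A.card_fixed_points_mod[OF p ord fin])
  also have "\<dots> = 0"
    using ord n by (simp add: order_def)
  finally have "p dvd card ?F" by (rule mod_0_imp_dvd)
  moreover have "\<one> \<in> ?F" by auto
  moreover have "\<not> p dvd 1"
    using p not_prime_1 by auto
  ultimately have "?F \<noteq> {\<one>}"
    by (metis card_1_singleton_iff One_nat_def)
  then obtain z where z: "z \<in> ?F" "z \<noteq> \<one>"
    using \<open>\<one> \<in> ?F\<close> by blast
  have "g \<otimes> z = z \<otimes> g" if "g \<in> carrier G" for g
  proof -
    have "g \<otimes> z \<otimes> inv g = z" using z that by auto
    then show ?thesis using z that by (metis (no_types, lifting) inv_solve_right' m_closed mem_Collect_eq)
  qed
  then show ?thesis using z by blast
qed

text \<open>
  The \<open>p\<close>-group \<open>Q\<close> acts on the cosets of \<open>P\<close>. Their number is prime to \<open>p\<close>, so \<open>Q\<close> fixes a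
  coset \<open>P a\<close>, which says that \<open>a Q a\<inverse>\<close> lies in \<open>P\<close>.
\<close>
lemma (in group) p_subgroup_conj_into:
  fixes p :: nat
  assumes fin: "finite (carrier G)" and p: "Factorial_Ring.prime p"
    and P: "subgroup P G" and np: "\<not> p dvd card (rcosets P)"
    and Q: "subgroup Q G" and cQ: "card Q = p ^ b"
  shows "\<exists>g\<in>carrier G. \<forall>q\<in>Q. g \<otimes> q \<otimes> inv g \<in> P"
proof -
  let ?Q = "G\<lparr>carrier := Q\<rparr>"
  \<comment> \<open>Right cosets are multiplied by inverses to obtain a left action.\<close>
  let ?f = "\<lambda>q C. C #> inv q"
  interpret Q: group ?Q
    using Q by (rule subgroup_imp_group)
  have QG: "q \<in> carrier G" if "q \<in> Q" for q
    by (rule subgroup.mem_carrier[OF Q that])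
  have PG: "P \<subseteq> carrier G"
    by (rule subgroup.subset[OF P])
  have "group_action ?Q (rcosets P) (\<lambda>g. restrict (?f g) (rcosets P))"
  proof (rule Q.group_action_restrict)
    fix g x assume g: "g \<in> carrier ?Q" and x: "x \<in> rcosets P"
    then obtain a where a: "a \<in> carrier G" "x = P #> a"
      by (auto simp: RCOSETS_def)
    then have "x #> inv g = P #> (a \<otimes> inv g)"
      using g QG PG by (simp add: coset_mult_assoc)
    then show "x #> inv g \<in> rcosets P"
      using a g QG by (auto simp: RCOSETS_def)
  next
    fix x assume "x \<in> rcosets P"
    then show "x #> inv (\<one>\<^bsub>?Q\<^esub>) = x"
      using subgroup.rcosets_carrier[OF P is_group] by simp
  next
    fix g h x assume "g \<in> carrier ?Q" "h \<in> carrier ?Q" and x: "x \<in> rcosets P"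
    then have "g \<in> carrier G" "h \<in> carrier G" "x \<subseteq> carrier G"
      using QG subgroup.rcosets_carrier[OF P is_group x] by auto
    then show "x #> inv (g \<otimes>\<^bsub>?Q\<^esub> h) = x #> inv h #> inv g"
      by (simp add: coset_mult_assoc inv_mult_group)
  qed
  then interpret A: group_action ?Q "rcosets P" "\<lambda>g. restrict (?f g) (rcosets P)" .
  let ?F = "{x \<in> rcosets P. \<forall>g\<in>carrier ?Q. restrict (?f g) (rcosets P) x = x}"
  have "finite (rcosets P)"
    unfolding RCOSETS_def by (simp add: fin)
  then have "card ?F mod p = card (rcosets P) mod p"
    using A.card_fixed_points_mod[OF p] cQ by (simp add: order_def)
  then have "card ?F \<noteq> 0"
    using np by (metis dvd_eq_mod_eq_0 mod_0)
  then obtain x where x: "x \<in> rcosets P" "\<forall>g\<in>Q. x #> inv g = x"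
    by (auto simp: card_eq_0_iff)
  then obtain a where a: "a \<in> carrier G" "x = P #> a"
    by (auto simp: RCOSETS_def)
  have "a \<otimes> q \<otimes> inv a \<in> P" if q: "q \<in> Q" for q
  proof -
    have "inv q \<in> Q" by (rule subgroup.m_inv_closed[OF Q q])
    then have "P #> a #> q = P #> a"
      using x a q QG by force
    then have "P #> (a \<otimes> q) = P #> a"
      using a q QG PG by (simp add: coset_mult_assoc)
    then have "a \<otimes> q \<in> P #> a"
      using rcos_self[of "a \<otimes> q" P] a q QG P by simp
    then show ?thesis
      using subgroup.rcos_module_imp[OF P is_group a(1)] by blast
  qed
  then show ?thesis using a by blast
qed

text \<open>
  Two groups of the same prime order are isomorphic because both are the quotient of the integers by
  the same subgroup.
\<close>
lemma prime_order_cyclic: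
  fixes K :: "('c, 'd) monoid_scheme"
  assumes p: "Factorial_Ring.prime p" and K: "group K" and oK: "order K = p"
  shows "\<exists>f. group_hom integer_group K f \<and> f ` UNIV = carrier K \<and>
      kernel integer_group K f = {i. int p dvd i}"
proof -
  interpret group K by fact
  have "1 < card (carrier K)"
    using prime_gt_1_nat[OF p] oK by (simp add: order_def)
  then have fin: "finite (carrier K)"
    using card.infinite by fastforce
  have "carrier K \<noteq> {\<one>\<^bsub>K\<^esub>}"
    using \<open>1 < card (carrier K)\<close> by auto
  then obtain x where x: "x \<in> carrier K" "x \<noteq> \<one>\<^bsub>K\<^esub>"
    using one_closed by blast
  have "ord x dvd p"
    using ord_dvd_group_order[OF x(1)] oK by simp
  moreover have "ord x \<noteq> 1"
    using x ord_eq_1 by blast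
  ultimately have ox: "ord x = p"
    using p by (metis prime_nat_iff)
  let ?f = "\<lambda>i :: int. x [^]\<^bsub>K\<^esub> i"
  have hom: "group_hom integer_group K ?f"
    using hom_integer_group_pow[OF x(1)] by (simp add: group_hom_def group_hom_axioms_def)
  have sub: "subgroup (?f ` UNIV) K"
    using group_hom.img_is_subgroup[OF hom] by simp
  have "card (?f ` UNIV) dvd p"
    using lagrange[OF sub] oK by (metis dvd_triv_right)
  moreover have "card (?f ` UNIV) \<noteq> 1"
  proof
    assume "card (?f ` UNIV) = 1"
    then obtain z where "?f ` UNIV = {z}" by (meson card_1_singletonE)
    then have "?f 1 = ?f 0" by (metis UNIV_I imageI singletonD)
    then show False using x by simp
  qed
  ultimately have "card (?f ` UNIV) = card (carrier K)"
    using p oK by (metis prime_nat_iff order_def)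
  then have "?f ` UNIV = carrier K"
    using card_subset_eq[OF fin] subgroup.subset[OF sub] by blast
  moreover have "kernel integer_group K ?f = {i. int p dvd i}"
    using int_pow_eq_id[OF x(1)] ox by (auto simp: kernel_def)
  ultimately show ?thesis using hom by blast
qed

lemma prime_order_iso:
  assumes G: "group G" and H: "group H" and p: "Factorial_Ring.prime p"
    and oG: "order G = p" and oH: "order H = p"
  shows "G \<cong> H"
proof -
  obtain f where f: "group_hom integer_group G f" "f ` UNIV = carrier G"
    "kernel integer_group G f = {i. int p dvd i}"
    using prime_order_cyclic[OF p G oG] by blast
  obtain g where g: "group_hom integer_group H g" "g ` UNIV = carrier H"
    "kernel integer_group H g = {i. int p dvd i}"
    using prime_order_cyclic[OF p H oH] by blast
  have a: "integer_group Mod {i. int p dvd i} \<cong> G"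
    using group_hom.FactGroup_iso[OF f(1)] f by simp
  have b: "integer_group Mod {i. int p dvd i} \<cong> H"
    using group_hom.FactGroup_iso[OF g(1)] g by simp
  have "group (integer_group Mod {i. int p dvd i})"
    using normal.factorgroup_is_group[OF group_hom.normal_kernel[OF f(1)]] f(3) by simp
  then show ?thesis
    using group.iso_sym a b iso_trans by blast
qed

definition center :: "('a, 'b) monoid_scheme \<Rightarrow> 'a set" where
  "center G = {z \<in> carrier G. \<forall>g\<in>carrier G. g \<otimes>\<^bsub>G\<^esub> z = z \<otimes>\<^bsub>G\<^esub> g}"

lemma (in group) center_normal_subgroup:
  assumes "subgroup C G" "C \<subseteq> center G"
  shows "C \<lhd> G"
proof -
  have "x \<otimes> h \<otimes> inv x = h" if "x \<in> carrier G" "h \<in> C" for x h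
  proof -
    have h: "h \<in> carrier G" "x \<otimes> h = h \<otimes> x"
      using assms that by (auto simp: center_def)
    then show ?thesis using that by (simp add: m_assoc)
  qed
  then show ?thesis
    using assms by (simp add: normal_inv_iff)
qed

lemma (in group) subgroup_center: "subgroup (center G) G"
proof (rule subgroupI)
  show "center G \<noteq> {}"
    by (auto simp: center_def intro: exI[of _ \<one>])
  show "inv a \<in> center G" if "a \<in> center G" for a
  proof -
    have a: "a \<in> carrier G" "\<And>g. g \<in> carrier G \<Longrightarrow> g \<otimes> a = a \<otimes> g"
      using that by (auto simp: center_def)
    have "g \<otimes> inv a = inv a \<otimes> g" if g: "g \<in> carrier G" for g
    proof -
      have "inv (inv g \<otimes> a) = inv (a \<otimes> inv g)"
        using a(2)[of "inv g"] g by simp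
      then show ?thesis using a(1) g by (simp add: inv_mult_group)
    qed
    then show ?thesis using a by (simp add: center_def)
  qed
  show "a \<otimes> b \<in> center G" if "a \<in> center G" "b \<in> center G" for a b
  proof -
    have a: "a \<in> carrier G" "\<And>g. g \<in> carrier G \<Longrightarrow> g \<otimes> a = a \<otimes> g"
      using that by (auto simp: center_def)
    have b: "b \<in> carrier G" "\<And>g. g \<in> carrier G \<Longrightarrow> g \<otimes> b = b \<otimes> g"
      using that by (auto simp: center_def)
    have "g \<otimes> (a \<otimes> b) = (a \<otimes> b) \<otimes> g" if g: "g \<in> carrier G" for g
    proof -
      have "g \<otimes> (a \<otimes> b) = a \<otimes> (g \<otimes> b)"
        using a(1) g b(1) by (simp add: a(2)[OF g] flip: m_assoc)
      then show ?thesis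
        using a(1) b(1) g by (simp add: b(2)[OF g] m_assoc)
    qed
    then show ?thesis using a(1) b(1) by (simp add: center_def)
  qed
qed (auto simp: center_def)

lemma (in group) card_center_p_group:
  fixes p :: nat
  assumes p: "Factorial_Ring.prime p" and ord: "order G = p ^ n" and n: "n > 0"
  obtains k where "k > 0" "card (center G) = p ^ k"
proof -
  have "card (center G) dvd p ^ n"
    using lagrange[OF subgroup_center] ord by (metis dvd_triv_right)
  then obtain k where k: "card (center G) = p ^ k"
    using p divides_primepow_nat by blast
  obtain z where z: "z \<in> center G" "z \<noteq> \<one>"
    using p_group_center_nontrivial[OF p ord n] by (auto simp: center_def)
  have "card (center G) \<noteq> 1"
  proof
    assume "card (center G) = 1"
    then obtain y where "center G = {y}" by (meson card_1_singletonE)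
    then show False
      using z subgroup.one_closed[OF subgroup_center] by auto
  qed
  then have "k > 0" using k by (cases k) auto
  then show ?thesis using k that by blast
qed

section \<open>Conjugation and the Frattini argument\<close>

definition (in group) conj_by :: "'a \<Rightarrow> 'a \<Rightarrow> 'a" where
  "conj_by g x = g \<otimes> x \<otimes> inv g"

context group
begin

lemma conj_closed [simp]: "g \<in> carrier G \<Longrightarrow> x \<in> carrier G \<Longrightarrow> conj_by g x \<in> carrier G"
  by (simp add: conj_by_def)

lemma conj_one [simp]: "x \<in> carrier G \<Longrightarrow> conj_by \<one> x = x"
  by (simp add: conj_by_def)

lemma conj_mult:
  "g \<in> carrier G \<Longrightarrow> h \<in> carrier G \<Longrightarrow> x \<in> carrier G \<Longrightarrow> conj_by (g \<otimes> h) x = conj_by g (conj_by h x)"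
  by (simp add: conj_by_def inv_mult_group m_assoc)

lemma group_hom_conj: "g \<in> carrier G \<Longrightarrow> group_hom G G (conj_by g)"
proof (intro group_hom.intro group_hom_axioms.intro homI is_group)
  fix x y assume "g \<in> carrier G" "x \<in> carrier G" "y \<in> carrier G"
  moreover from this have "inv g \<otimes> (g \<otimes> (y \<otimes> inv g)) = y \<otimes> inv g"
    by (simp flip: m_assoc)
  ultimately show "conj_by g (x \<otimes> y) = conj_by g x \<otimes> conj_by g y"
    by (simp add: conj_by_def m_assoc)
qed simp

lemma conj_image_mult:
  assumes "g \<in> carrier G" "h \<in> carrier G" "A \<subseteq> carrier G"
  shows "conj_by (g \<otimes> h) ` A = conj_by g ` conj_by h ` A"
  using assms by (auto simp: image_image conj_mult subset_iff intro!: image_cong)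

lemma conj_image_one: "A \<subseteq> carrier G \<Longrightarrow> conj_by \<one> ` A = A"
  by (force simp: image_iff)

lemma conj_image_inv:
  assumes "g \<in> carrier G" "A \<subseteq> carrier G"
  shows "conj_by (inv g) ` conj_by g ` A = A" "conj_by g ` conj_by (inv g) ` A = A"
  using assms conj_image_mult[of "inv g" g A] conj_image_mult[of g "inv g" A] by (simp_all add: conj_image_one)

lemma inj_on_conj: "g \<in> carrier G \<Longrightarrow> inj_on (conj_by g) (carrier G)"
  by (rule inj_onI) (simp add: conj_by_def)

lemma card_conj_image: "g \<in> carrier G \<Longrightarrow> A \<subseteq> carrier G \<Longrightarrow> card (conj_by g ` A) = card A"
  by (rule card_image) (rule inj_on_subset[OF inj_on_conj])

lemma conj_coset: "g <# A #> inv g = conj_by g ` A"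
  by (auto simp: l_coset_def r_coset_def conj_by_def)

lemma normal_conj_image:
  assumes "N \<lhd> G" "g \<in> carrier G" "A \<subseteq> N"
  shows "conj_by g ` A \<subseteq> N"
  using normal.inv_op_closed2[OF assms(1,2)] assms(3) by (auto simp: conj_by_def)

lemma normalizer_eq:
  assumes "A \<subseteq> carrier G"
  shows "normalizer G A = {g \<in> carrier G. conj_by g ` A = A}"
  using assms by (simp add: normalizer_def stabilizer_def conj_coset)

text \<open>
  The conjugate of the Sylow subgroup \<open>P\<close> of \<open>N\<close> by \<open>g\<close> is another Sylow subgroup of \<open>N\<close>, and an
  element of \<open>N\<close> moves it back to \<open>P\<close>. So the normalizer of \<open>P\<close> covers \<open>G\<close> modulo \<open>N\<close>.
\<close>
lemma frattini:
  fixes p :: nat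
  assumes fin: "finite (carrier G)" and N: "N \<lhd> G" and P: "subgroup P G" and PN: "P \<subseteq> N"
    and p: "Factorial_Ring.prime p" and cP: "card P = p ^ a" and cN: "card N = p ^ a * m"
    and np: "\<not> p dvd m" and g: "g \<in> carrier G"
  shows "\<exists>n\<in>N. n \<otimes> g \<in> normalizer G P"
proof -
  let ?N = "G\<lparr>carrier := N\<rparr>"
  have subN: "subgroup N G"
    using N by (rule normal_imp_subgroup)
  have NG: "N \<subseteq> carrier G" and PG: "P \<subseteq> carrier G"
    using subgroup.subset subN P by blast+
  interpret N: group ?N
    using subN by (rule subgroup_imp_group)
  let ?Q = "conj_by g ` P"
  have PN': "subgroup P ?N"
    by (rule subgroup_incl[OF P subN PN])
  have QN: "?Q \<subseteq> N"
    by (rule normal_conj_image[OF N g PN])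
  have Q: "subgroup ?Q G"
    by (rule group_hom.subgroup_img_is_subgroup[OF group_hom_conj[OF g] P])
  have "card (rcosets\<^bsub>?N\<^esub> P) * p ^ a = p ^ a * m"
    using N.lagrange[OF PN'] cP cN by (simp add: order_def)
  then have "card (rcosets\<^bsub>?N\<^esub> P) = m"
    using p by (simp add: prime_gt_0_nat)
  then obtain n where n: "n \<in> N" "\<forall>q\<in>?Q. n \<otimes> q \<otimes> inv\<^bsub>?N\<^esub> n \<in> P"
    using N.p_subgroup_conj_into[OF _ p PN' _ subgroup_incl[OF Q subN QN], of a] fin NG np
      card_conj_image[OF g PG] cP finite_subset by auto
  have nG: "n \<in> carrier G" using n NG by blast
  have "conj_by n ` ?Q \<subseteq> P"
    using n subN by (auto simp: conj_by_def m_inv_consistent)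
  then have "conj_by (n \<otimes> g) ` P \<subseteq> P"
    using conj_image_mult[OF nG g PG] by simp
  moreover have "card (conj_by (n \<otimes> g) ` P) = card P"
    using nG g PG by (simp add: card_conj_image)
  moreover have "finite P"
    using PG fin finite_subset by blast
  ultimately have "conj_by (n \<otimes> g) ` P = P"
    by (simp add: card_subset_eq)
  then show ?thesis
    using n(1) nG g by (auto simp: normalizer_eq[OF PG])
qed

end

text \<open>The centre is a characteristic subgroup.\<close>
lemma (in group) center_of_normal:
  assumes P: "P \<lhd> G"
  shows "center (G\<lparr>carrier := P\<rparr>) \<lhd> G"
proof -
  let ?P = "G\<lparr>carrier := P\<rparr>"
  have sP: "subgroup P G" using P by (rule normal_imp_subgroup)
  have PG: "x \<in> carrier G" if "x \<in> P" for x
    using subgroup.mem_carrier[OF sP that] .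
  have "subgroup (center ?P) G"
    using incl_subgroup[OF sP group.subgroup_center[OF subgroup_imp_group[OF sP]]] .
  moreover have "g \<otimes> z \<otimes> inv g \<in> center ?P" if g: "g \<in> carrier G" and z: "z \<in> center ?P" for g z
  proof -
    interpret c: group_hom G G "conj_by g" by (rule group_hom_conj[OF g])
    have zP: "z \<in> P" and zc: "\<And>x. x \<in> P \<Longrightarrow> x \<otimes> z = z \<otimes> x"
      using z by (auto simp: center_def)
    have conjP: "conj_by a x \<in> P" if "a \<in> carrier G" "x \<in> P" for a x
      using normal.inv_op_closed2[OF P that] by (simp add: conj_by_def)
    have "x \<otimes> conj_by g z = conj_by g z \<otimes> x" if x: "x \<in> P" for x
    proof -
      let ?y = "conj_by (inv g) x"
      have y: "?y \<in> P" using conjP g x by simp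
      have x': "x = conj_by g ?y"
        using g PG[OF x] conj_mult[of g "inv g" x] by simp
      show ?thesis
        using zc[OF y] c.hom_mult[of ?y z] c.hom_mult[of z ?y] PG[OF y] PG[OF zP] x' by metis
    qed
    then show ?thesis
      using conjP[OF g zP] by (simp add: center_def conj_by_def)
  qed
  ultimately show ?thesis
    by (simp add: normal_inv_iff)
qed

section \<open>Complements of abelian normal subgroups of coprime index\<close>

lemma (in comm_group) finprod_hom:
  assumes h: "h \<in> hom G G" and f: "f \<in> A \<rightarrow> carrier G"
  shows "h (finprod G f A) = finprod G (\<lambda>x. h (f x)) A"
proof -
  interpret h: group_hom G G h
    using h by (simp add: group_hom_def group_hom_axioms_def)
  show ?thesis
  proof (cases "finite A")
    case True
    then show ?thesis
      using f
    proof (induction A rule: finite_induct)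
      case (insert a A)
      then have "f \<in> A \<rightarrow> carrier G" "f a \<in> carrier G"
        by auto
      moreover from this have "(\<lambda>x. h (f x)) \<in> A \<rightarrow> carrier G"
        using h.hom_closed by fast
      ultimately show ?case
        using insert.hyps insert.IH by simp
    qed simp
  qed simp
qed

text \<open>
  This is the abelian case of the Schur-Zassenhaus theorem. For a transversal \<open>t\<close> of the cosets of
  \<open>Z\<close>, averaging the cocycle of \<open>t\<close> over all cosets \<open>c\<close> gives the function
  \<open>V g = (\<Prod>c. g t(c) t(g c)\<inverse>)\<close> with values in \<open>Z\<close>, which satisfies
  \<open>V (g h) = (g (V h) g\<inverse>) (V g)\<close> and is the power map \<open>x \<mapsto> x ^ n\<close> on \<open>Z\<close>, where \<open>n\<close> is the index of
  \<open>Z\<close>. Because \<open>n\<close> is prime to the order of \<open>Z\<close>, this power map is bijective, and therefore the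
  subgroup \<open>V g = \<one>\<close> meets \<open>Z\<close> trivially and meets each of its cosets.
\<close>
lemma (in group) abelian_normal_coprime_complement:
  assumes fin: "finite (carrier G)" and Z: "Z \<lhd> G"
    and comm: "\<And>x y. x \<in> Z \<Longrightarrow> y \<in> Z \<Longrightarrow> x \<otimes> y = y \<otimes> x"
    and cop: "coprime (card (rcosets Z)) (card Z)"
  shows "\<exists>C. subgroup C G \<and> C \<inter> Z = {\<one>} \<and> (\<forall>g\<in>carrier G. \<exists>z\<in>Z. z \<otimes> g \<in> C)"
proof -
  let ?Z = "G\<lparr>carrier := Z\<rparr>"
  let ?R = "rcosets Z"
  interpret N: normal Z G by (rule Z)
  have subZ: "subgroup Z G"
    by (rule N.subgroup_axioms)
  have ZG: "x \<in> carrier G" if "x \<in> Z" for x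
    using that by simp
  interpret Zg: group ?Z
    by (rule subgroup_imp_group[OF subZ])
  interpret Z: comm_group ?Z
    by (rule Zg.group_comm_groupI) (simp add: comm)
  have cancel: "inv g \<otimes> (g \<otimes> y) = y" "g \<otimes> (inv g \<otimes> y) = y"
    if "g \<in> carrier G" "y \<in> carrier G" for g y
    using that by (simp_all flip: m_assoc)

  define t where "t c = (SOME x. x \<in> c)" for c :: "'a set"
  define act where "act g c = Z #> (g \<otimes> t c)" for g c
  define v where "v g c = g \<otimes> t c \<otimes> inv (t (act g c))" for g c
  define V where "V g = finprod ?Z (v g) ?R" for g

  have t: "t c \<in> carrier G" "Z #> t c = c" if c: "c \<in> ?R" for c
  proof -
    obtain a where a: "a \<in> carrier G" "c = Z #> a"
      using c by (auto simp: RCOSETS_def)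
    have "a \<in> c"
      using rcos_self[OF a(1) subZ] a(2) by simp
    then have tc: "t c \<in> c"
      unfolding t_def by (rule someI)
    show "t c \<in> carrier G"
      using tc a by (metis r_coset_subset_G subsetD N.subset)
    show "Z #> t c = c"
      using repr_independence[OF _ a(1) subZ] tc a(2) by simp
  qed
  have RG: "Z #> x \<in> ?R" if "x \<in> carrier G" for x
    using that by (auto simp: RCOSETS_def)
  have act_closed: "act g c \<in> ?R" if "g \<in> carrier G" "c \<in> ?R" for g c
    unfolding act_def using that t by (intro RG) simp
  have act_mult: "act (g \<otimes> h) c = act g (act h c)"
    if "g \<in> carrier G" "h \<in> carrier G" "c \<in> ?R" for g h c
  proof -
    have "act g (act h c) = (Z #> g) <#> (Z #> t (act h c))"
      unfolding act_def[of g] using that t(1)[OF act_closed[of h c]] by (simp only: N.rcos_sum)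
    also have "\<dots> = (Z #> g) <#> (Z #> (h \<otimes> t c))"
      using that t(2)[OF act_closed[of h c]] by (simp add: act_def)
    also have "\<dots> = act (g \<otimes> h) c"
      using that t[OF that(3)] by (simp add: act_def N.rcos_sum m_assoc)
    finally show ?thesis by simp
  qed
  have act_Z: "act x c = c" if "x \<in> Z" "c \<in> ?R" for x c
  proof -
    have "act x c = (Z #> x) #> t c"
      using that t(1)[OF that(2)] N.subset by (simp add: act_def coset_mult_assoc)
    also have "Z #> x = Z"
      using coset_join2[OF _ subZ that(1)] that(1) by simp
    finally show ?thesis using t that by simp
  qed
  have act_bij: "bij_betw (act h) ?R ?R" if h: "h \<in> carrier G" for h
  proof (rule bij_betwI[where g = "act (inv h)"])
    show "act (inv h) (act h c) = c" "act h (act (inv h) c) = c" if "c \<in> ?R" for c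
      using that h act_mult[of "inv h" h c] act_mult[of h "inv h" c] act_Z[of \<one> c] N.one_closed
      by simp_all
  qed (use act_closed h in auto)
  have v_closed: "v g c \<in> Z" if "g \<in> carrier G" "c \<in> ?R" for g c
  proof -
    note tt = t[OF act_closed[OF that]] t[OF that(2)]
    have "Z #> t (act g c) = Z #> (g \<otimes> t c)"
      using tt by (simp add: act_def)
    then have "g \<otimes> t c \<in> Z #> t (act g c)"
      using rcos_self[of "g \<otimes> t c" Z] that tt subZ by simp
    then show ?thesis
      unfolding v_def using N.rcos_module_imp[OF is_group tt(1)] by blast
  qed
  have V_closed: "V g \<in> Z" if "g \<in> carrier G" for g
    unfolding V_def using Z.finprod_closed[of "v g" ?R] v_closed that by auto
  have v_mult: "v (g \<otimes> h) c = (g \<otimes> v h c \<otimes> inv g) \<otimes> v g (act h c)"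
    if "g \<in> carrier G" "h \<in> carrier G" "c \<in> ?R" for g h c
    using that t(1)[OF that(3)] t(1)[OF act_closed[OF that(2,3)]]
      t(1)[OF act_closed[OF that(1) act_closed[OF that(2,3)]]]
    by (simp add: v_def act_mult m_assoc cancel)
  have V_mult: "V (g \<otimes> h) = (g \<otimes> V h \<otimes> inv g) \<otimes> V g"
    if g: "g \<in> carrier G" and h: "h \<in> carrier G" for g h
  proof -
    have conj_closed: "g \<otimes> x \<otimes> inv g \<in> Z" if "x \<in> Z" for x
      using that g by (rule N.inv_op_closed2[rotated])
    have conj_hom: "(\<lambda>x. g \<otimes> x \<otimes> inv g) \<in> hom ?Z ?Z"
    proof (rule homI)
      show "g \<otimes> (x \<otimes>\<^bsub>?Z\<^esub> y) \<otimes> inv g = (g \<otimes> x \<otimes> inv g) \<otimes>\<^bsub>?Z\<^esub> (g \<otimes> y \<otimes> inv g)"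
        if "x \<in> carrier ?Z" "y \<in> carrier ?Z" for x y
        using that g by (simp add: m_assoc cancel)
    qed (use conj_closed in simp)
    have "V (g \<otimes> h) = finprod ?Z (\<lambda>c. (g \<otimes> v h c \<otimes> inv g) \<otimes>\<^bsub>?Z\<^esub> v g (act h c)) ?R"
      unfolding V_def
      by (rule Z.finprod_cong') (use g h v_mult v_closed conj_closed act_closed in auto)
    also have "\<dots> = finprod ?Z (\<lambda>c. g \<otimes> v h c \<otimes> inv g) ?R \<otimes>\<^bsub>?Z\<^esub> finprod ?Z (\<lambda>c. v g (act h c)) ?R"
      by (rule Z.finprod_multf) (use g h v_closed conj_closed act_closed in auto)
    also have "finprod ?Z (\<lambda>c. g \<otimes> v h c \<otimes> inv g) ?R = g \<otimes> V h \<otimes> inv g"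
      unfolding V_def
      by (rule Z.finprod_hom[OF conj_hom, symmetric]) (use h v_closed in auto)
    also have "finprod ?Z (\<lambda>c. v g (act h c)) ?R = V g"
      unfolding V_def
      using Z.finprod_reindex[of "v g" "act h" ?R] act_bij[OF h] v_closed g
      by (auto simp: bij_betw_def)
    finally show ?thesis by simp
  qed
  have V_Z: "V x = x [^] card ?R" if x: "x \<in> Z" for x
  proof -
    have "V x = finprod ?Z (\<lambda>c. x) ?R"
      unfolding V_def
    proof (rule Z.finprod_cong')
      fix c assume c: "c \<in> ?R"
      show "v x c = x"
        using x t[OF c] by (simp add: v_def act_Z[OF x c] m_assoc)
    qed (use x in auto)
    also have "\<dots> = x [^]\<^bsub>?Z\<^esub> card ?R"
      using Z.finprod_const[of x ?R] x by simp
    finally show ?thesis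
      by (simp add: nat_pow_consistent[symmetric])
  qed

  define C where "C = {g \<in> carrier G. V g = \<one>}"
  have Vone: "V \<one> = \<one>"
    using V_Z[OF N.one_closed] by simp
  have "subgroup C G"
  proof (rule subgroupI)
    show "C \<noteq> {}" using Vone by (auto simp: C_def)
    show "inv a \<in> C" if "a \<in> C" for a
    proof -
      have a: "a \<in> carrier G" "V a = \<one>" using that by (auto simp: C_def)
      have "V (inv a) \<in> carrier G" using V_closed[of "inv a"] a by simp
      then have "V (inv a) = \<one>"
        using V_mult[of "inv a" a] a Vone by simp
      then show ?thesis using a by (simp add: C_def)
    qed
    show "a \<otimes> b \<in> C" if "a \<in> C" "b \<in> C" for a b
      using that V_mult by (simp add: C_def)
  qed (auto simp: C_def)
  moreover have "C \<inter> Z = {\<one>}"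
  proof -
    have "x = \<one>" if "x \<in> C" "x \<in> Z" for x
    proof -
      have x: "x \<in> carrier G" using that by simp
      have "x [^] card ?R = \<one>" using V_Z[OF that(2)] that by (simp add: C_def)
      then have "ord x dvd card ?R" by (simp add: pow_eq_id x)
      moreover have "x [^] card Z = \<one>"
        using Zg.pow_order_eq_1[of x] that(2) by (simp add: order_def nat_pow_consistent[symmetric])
      then have "ord x dvd card Z" by (simp add: pow_eq_id x)
      ultimately have "ord x = 1"
        using coprime_common_divisor[OF cop] by (metis nat_dvd_1_iff_1)
      then show ?thesis using ord_eq_1[OF x] by simp
    qed
    then show ?thesis
      using Vone N.one_closed by (auto simp: C_def)
  qed
  moreover have "\<exists>z\<in>Z. z \<otimes> g \<in> C" if g: "g \<in> carrier G" for g
  proof -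
    have cZ: "card Z \<noteq> 0"
      using N.finite_imp_card_positive[OF fin] by simp
    have cR: "card ?R \<noteq> 0"
      using lagrange[OF subZ] fin order_gt_0_iff_finite by (metis mult_0 less_irrefl)
    \<comment> \<open>The element \<open>z\<close> is the \<open>n\<close>-th root of \<open>(V g)\<inverse>\<close> in \<open>Z\<close>, so that \<open>V (z g) = V g V z = \<one>\<close>.\<close>
    obtain i j where ij: "card ?R * i = card Z * j + 1"
      using cop bezout_nat[OF cR, of "card Z"] by (auto simp: coprime_iff_gcd_eq_1)
    let ?w = "inv (V g)"
    have w: "?w \<in> Z" using V_closed[OF g] by simp
    define z where "z = ?w [^] i"
    have z: "z \<in> Z"
      unfolding z_def using Zg.nat_pow_closed[of ?w i] w by (simp add: nat_pow_consistent[symmetric])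
    have wZ: "?w [^] card Z = \<one>"
      using Zg.pow_order_eq_1[of ?w] w by (simp add: order_def nat_pow_consistent[symmetric])
    have "z [^] card ?R = ?w [^] (card Z * j + 1)"
      unfolding z_def using ij V_closed[OF g] by (simp add: nat_pow_pow mult.commute)
    also have "\<dots> = (?w [^] card Z) [^] j \<otimes> ?w"
      using V_closed[OF g] by (simp add: nat_pow_pow nat_pow_mult[symmetric])
    also have "\<dots> = ?w"
      using V_closed[OF g] wZ by simp
    finally have Vz: "V z = ?w" using V_Z[OF z] by simp
    have "V (z \<otimes> g) = (z \<otimes> V g \<otimes> inv z) \<otimes> V z"
      using V_mult[of z g] z g by simp
    also have "z \<otimes> V g \<otimes> inv z = V g"
      using comm[OF z V_closed[OF g]] z V_closed[OF g] by (simp add: m_assoc)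
    finally have "V (z \<otimes> g) = \<one>"
      using Vz V_closed[OF g] by simp
    then show ?thesis
      using z g by (auto simp: C_def)
  qed
  ultimately show ?thesis by blast
qed

section \<open>Closure properties of a complete class\<close>

definition X_subgroup :: "nat monoid set \<Rightarrow> ('a, 'b) monoid_scheme \<Rightarrow> 'a set \<Rightarrow> bool" where
  "X_subgroup \<XX> G H \<longleftrightarrow> subgroup H G \<and> in_class \<XX> (G\<lparr>carrier := H\<rparr>)"

lemma in_class_iso: "G \<cong> H \<Longrightarrow> in_class \<XX> H \<Longrightarrow> in_class \<XX> G"
  unfolding in_class_def using iso_trans by blast

locale complete_group_class =
  fixes \<XX> :: "nat monoid set"
  assumes complete: "complete_class \<XX>"
begin

lemma in_class_finite: "in_class \<XX> G \<Longrightarrow> finite (carrier G)"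
  using complete iso_finite
  by (fastforce simp: in_class_def complete_class_def group_class_def finite_group_def)

lemma class_finite_group: "K \<in> \<XX> \<Longrightarrow> finite_group K"
  using complete by (auto simp: complete_class_def group_class_def)

lemma in_class_nat: "K \<in> \<XX> \<Longrightarrow> in_class \<XX> K"
  unfolding in_class_def using iso_refl by blast

lemma in_class_subgroup:
  assumes G: "group G" and cl: "in_class \<XX> G" and H: "subgroup H G"
  shows "in_class \<XX> (G\<lparr>carrier := H\<rparr>)"
proof -
  obtain K f where K: "K \<in> \<XX>" and f: "f \<in> iso G K"
    using cl by (auto simp: in_class_def is_iso_def)
  have gK: "group K" using class_finite_group[OF K] by (simp add: finite_group_def)
  have "subgroup (f ` H) K"
    by (rule subgroup.iso_subgroup[OF H G gK f])
  then have "in_class \<XX> (K\<lparr>carrier := f ` H\<rparr>)"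
    using complete K by (simp add: complete_class_def)
  moreover have "G\<lparr>carrier := H\<rparr> \<cong> K\<lparr>carrier := f ` H\<rparr>"
    using iso_restrict[OF f G gK H] by (rule is_isoI)
  ultimately show ?thesis by (rule in_class_iso[rotated])
qed

text \<open>
  The closure properties in the definition of a complete class concern groups on natural numbers.
  Here and in \<open>in_class_extension\<close> they are carried over to arbitrary types.
\<close>
lemma in_class_epi:
  assumes f: "group_hom G H f" and surj: "f ` carrier G = carrier H" and cl: "in_class \<XX> G"
  shows "in_class \<XX> H"
proof -
  interpret f: group_hom G H f by fact
  obtain K g where K: "K \<in> \<XX>" and g: "g \<in> iso G K"
    using cl by (auto simp: in_class_def is_iso_def)
  have "finite (carrier H)"
    using in_class_finite[OF cl] surj by (metis finite_imageI)
  then have "finite_group H"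
    by (simp add: finite_group_def)
  then obtain L :: "nat monoid" and h where L: "finite_group L" and h: "h \<in> iso H L"
    by (rule nat_copy)
  have gL: "group L" using L by (simp add: finite_group_def)
  have "f \<in> epi G H"
    using epi_iff_group_hom[of G H f] f surj by simp
  moreover have "inv_into (carrier G) g \<in> epi K G"
    using f.G.iso_set_sym[OF g] by (simp add: iso_iff_mon_epi)
  moreover have "h \<in> epi H L"
    using h by (simp add: iso_iff_mon_epi)
  ultimately have "h \<circ> (f \<circ> inv_into (carrier G) g) \<in> epi K L"
    by (meson epi_compose)
  then have "epi K L \<noteq> {}" by blast
  then have "in_class \<XX> L"
    using complete K gL by (simp add: complete_class_def)
  then show ?thesis
    using in_class_iso is_isoI[OF h] by blast
qed

lemma in_class_iso_image: "group G \<Longrightarrow> G \<cong> H \<Longrightarrow> in_class \<XX> G \<Longrightarrow> in_class \<XX> H"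
  using in_class_iso group.iso_sym by blast

lemma in_class_extension:
  assumes f: "group_hom G H f" and surj: "f ` carrier G = carrier H" and fin: "finite (carrier G)"
    and clH: "in_class \<XX> H" and clN: "in_class \<XX> (G\<lparr>carrier := kernel G H f\<rparr>)"
  shows "in_class \<XX> G"
proof -
  interpret f: group_hom G H f by fact
  let ?N = "kernel G H f"
  have "finite_group G" using fin by (simp add: finite_group_def)
  then obtain L :: "nat monoid" and h where L: "finite_group L" and h: "h \<in> iso G L"
    by (rule nat_copy)
  have gL: "group L" using L by (simp add: finite_group_def)
  have bij: "bij_betw h (carrier G) (carrier L)" using h by (simp add: iso_def)
  let ?i = "inv_into (carrier G) h"
  have i: "?i \<in> iso L G" by (rule f.G.iso_set_sym[OF h])
  have "f \<circ> ?i \<in> epi L H"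
    using i f surj epi_iff_group_hom[of G H f] epi_compose[of ?i L G f H] by (simp add: iso_iff_mon_epi)
  then have fi: "group_hom L H (f \<circ> ?i)" and fi_surj: "(f \<circ> ?i) ` carrier L = carrier H"
    using epi_iff_group_hom[OF gL f.H.is_group] by auto
  have ker: "kernel L H (f \<circ> ?i) = h ` ?N"
  proof -
    have "carrier L = h ` carrier G" "inj_on h (carrier G)"
      using bij by (auto simp: bij_betw_def)
    then show ?thesis by (auto simp: kernel_def)
  qed
  have N: "subgroup ?N G" by (rule f.subgroup_kernel)
  have "G\<lparr>carrier := ?N\<rparr> \<cong> L\<lparr>carrier := h ` ?N\<rparr>"
    using iso_restrict[OF h f.G.is_group gL N] by (rule is_isoI)
  then have "in_class \<XX> (L\<lparr>carrier := h ` ?N\<rparr>)"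
    using in_class_iso_image[OF f.G.subgroup_imp_group[OF N]] clN by blast
  moreover have "h ` ?N \<lhd> L"
    using group_hom.normal_kernel[OF fi] ker by simp
  moreover have "in_class \<XX> (L Mod (h ` ?N))"
    using group_hom.FactGroup_iso[OF fi fi_surj] in_class_iso clH ker by simp
  ultimately have "in_class \<XX> L"
    using complete L unfolding complete_class_def by blast
  then show ?thesis
    using in_class_iso is_isoI[OF h] by blast
qed

lemma X_subgroup_image:
  assumes f: "group_hom G H f" and K: "X_subgroup \<XX> G K"
  shows "X_subgroup \<XX> H (f ` K)"
proof -
  have K': "subgroup K G" "in_class \<XX> (G\<lparr>carrier := K\<rparr>)"
    using K by (auto simp: X_subgroup_def)
  have "group_hom (G\<lparr>carrier := K\<rparr>) (H\<lparr>carrier := f ` K\<rparr>) f"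
    by (rule group_hom.induced_group_hom[OF f K'(1)])
  then have "in_class \<XX> (H\<lparr>carrier := f ` K\<rparr>)"
    using in_class_epi K'(2) by fastforce
  then show ?thesis
    using group_hom.subgroup_img_is_subgroup[OF f K'(1)] by (simp add: X_subgroup_def)
qed

lemma X_subgroup_extension:
  assumes f: "group_hom G H f" and fin: "finite (carrier G)" and K: "subgroup K G"
    and image: "in_class \<XX> (H\<lparr>carrier := f ` K\<rparr>)"
    and ker: "in_class \<XX> (G\<lparr>carrier := K \<inter> kernel G H f\<rparr>)"
  shows "X_subgroup \<XX> G K"
proof -
  have hom: "group_hom (G\<lparr>carrier := K\<rparr>) (H\<lparr>carrier := f ` K\<rparr>) f"
    by (rule group_hom.induced_group_hom[OF f K])
  have "kernel (G\<lparr>carrier := K\<rparr>) (H\<lparr>carrier := f ` K\<rparr>) f = K \<inter> kernel G H f"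
    using subgroup.subset[OF K] by (auto simp: kernel_def)
  moreover have "finite K"
    using subgroup.subset[OF K] fin finite_subset by blast
  ultimately have "in_class \<XX> (G\<lparr>carrier := K\<rparr>)"
    using in_class_extension[OF hom] image ker by simp
  then show ?thesis using K by (simp add: X_subgroup_def)
qed

lemma X_subgroup_mono:
  assumes G: "group G" and K: "X_subgroup \<XX> G K" and H: "subgroup H G" and HK: "H \<subseteq> K"
  shows "X_subgroup \<XX> G H"
proof -
  have K': "subgroup K G" "in_class \<XX> (G\<lparr>carrier := K\<rparr>)"
    using K by (auto simp: X_subgroup_def)
  have "in_class \<XX> (G\<lparr>carrier := K, carrier := H\<rparr>)"
    using in_class_subgroup[OF group.subgroup_imp_group[OF G K'(1)] K'(2)]
      group.subgroup_incl[OF G H K'(1) HK] .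
  then show ?thesis using H by (simp add: X_subgroup_def)
qed

lemma X_subgroup_trans:
  assumes G: "group G" and Y: "subgroup Y G" and H: "X_subgroup \<XX> (G\<lparr>carrier := Y\<rparr>) H"
  shows "X_subgroup \<XX> G H"
  using group.incl_subgroup[OF G Y] H by (simp add: X_subgroup_def)

end

context complete_group_class
begin

definition class_prime :: "nat \<Rightarrow> bool" where
  "class_prime p \<longleftrightarrow> Factorial_Ring.prime p \<and> (\<exists>K\<in>\<XX>. p dvd order K)"

lemma class_primeI:
  assumes "Factorial_Ring.prime p" "in_class \<XX> G" "p dvd card (carrier G)"
  shows "class_prime p"
proof -
  obtain K where "K \<in> \<XX>" "G \<cong> K"
    using assms(2) by (auto simp: in_class_def)
  then show ?thesis
    using assms iso_same_card[of G K] by (auto simp: class_prime_def order_def)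
qed

lemma in_class_trivial:
  assumes G: "group G" and one: "carrier G = {\<one>\<^bsub>G\<^esub>}"
  shows "in_class \<XX> G"
proof -
  obtain K where K: "K \<in> \<XX>"
    using complete by (auto simp: complete_class_def)
  have gK: "group K" using class_finite_group[OF K] by (simp add: finite_group_def)
  then have "group_hom K G (\<lambda>x. \<one>\<^bsub>G\<^esub>)"
    using trivial_hom[OF G] G by (simp add: group_hom_def group_hom_axioms_def)
  moreover have "(\<lambda>x. \<one>\<^bsub>G\<^esub>) ` carrier K = carrier G"
    using one monoid.one_closed[OF group.is_monoid[OF gK]] by auto
  ultimately show ?thesis
    using in_class_epi in_class_nat[OF K] by blast
qed

lemma in_class_prime_order:
  assumes p: "class_prime p" and G: "group G" and o: "order G = p"
  shows "in_class \<XX> G"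
proof -
  obtain K where K: "K \<in> \<XX>" "p dvd order K" and pr: "Factorial_Ring.prime p"
    using p by (auto simp: class_prime_def)
  have gK: "group K" "finite (carrier K)" using class_finite_group[OF K(1)] by (auto simp: finite_group_def)
  obtain m where "order K = p ^ 1 * m" using K(2) by auto
  then obtain S where S: "subgroup S K" "card S = p ^ 1"
    using sylow_thm[OF pr gK(1) _ gK(2)] by blast
  have "G \<cong> K\<lparr>carrier := S\<rparr>"
    using prime_order_iso[OF G group.subgroup_imp_group[OF gK(1) S(1)] pr o] S(2) by (simp add: order_def)
  moreover have "in_class \<XX> (K\<lparr>carrier := S\<rparr>)"
    by (rule in_class_subgroup[OF gK(1) in_class_nat[OF K(1)] S(1)])
  ultimately show ?thesis by (rule in_class_iso)
qed

text \<open>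
  A central subgroup of order \<open>p\<close> exists by Sylow's theorem in the centre; it and, by induction, its
  quotient are in the class. The induction passes to a quotient, which is possible only in a
  formulation where the quotient can be replaced by a group on the same type.
\<close>
lemma in_class_p_group_nat:
  fixes G :: "nat monoid"
  assumes p: "class_prime p" and G: "group G" and o: "order G = p ^ n"
  shows "in_class \<XX> G"
  using G o
proof (induction n arbitrary: G)
  case 0
  then show ?case
    using group.order_one_triv_iff in_class_trivial by fastforce
next
  case (Suc n)
  interpret group G by (rule Suc.prems)
  have pr: "Factorial_Ring.prime p" using p by (simp add: class_prime_def)
  have fin: "finite (carrier G)"
    using Suc.prems(2) pr order_gt_0_iff_finite by (metis prime_gt_0_nat zero_less_power)
  let ?Z = "G\<lparr>carrier := center G\<rparr>"
  obtain k where k: "k > 0" "card (center G) = p ^ k"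
    using card_center_p_group[OF pr Suc.prems(2)] by blast
  have gZ: "group ?Z" by (rule subgroup_imp_group[OF subgroup_center])
  have "order ?Z = p ^ 1 * p ^ (k - 1)"
    using k by (cases k) (auto simp: order_def)
  moreover have "finite (carrier ?Z)"
    using fin by (simp add: center_def)
  ultimately obtain C where C: "subgroup C ?Z" "card C = p ^ 1"
    using sylow_thm[OF pr gZ] by blast
  have CG: "subgroup C G"
    by (rule incl_subgroup[OF subgroup_center C(1)])
  have nC: "C \<lhd> G"
    using center_normal_subgroup[OF CG] subgroup.subset[OF C(1)] by simp
  have "finite_group G" using fin by (simp add: finite_group_def)
  then obtain L :: "nat monoid" and q where
    q: "group_hom G L q" "q ` carrier G = carrier L" "kernel G L q = C"
    using quotient_nat_copy[OF _ nC] by blast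
  have "order L * p = order G"
    using epi_card[OF q(1,2)] q(3) C(2) by (simp add: order_def)
  then have "order L = p ^ n"
    using Suc.prems(2) pr by (simp add: prime_gt_0_nat)
  then have "in_class \<XX> L"
    using Suc.IH q(1) by (simp add: group_hom_def)
  moreover have "in_class \<XX> (G\<lparr>carrier := C\<rparr>)"
    using in_class_prime_order[OF p subgroup_imp_group[OF CG]] C(2) by (simp add: order_def)
  ultimately show ?case
    using in_class_extension[OF q(1,2) fin] q(3) by simp
qed

lemma in_class_p_group:
  assumes p: "class_prime p" and G: "group G" and o: "order G = p ^ n"
  shows "in_class \<XX> G"
proof -
  have "finite (carrier G)"
    using o p monoid.order_gt_0_iff_finite[OF group.is_monoid[OF G]]
    by (metis class_prime_def prime_gt_0_nat zero_less_power)
  then obtain L :: "nat monoid" and h where L: "finite_group L" "h \<in> iso G L"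
    using nat_copy[of G] G by (auto simp: finite_group_def)
  then have "G \<cong> L" by (simp add: is_isoI)
  then show ?thesis
    using in_class_iso in_class_p_group_nat[OF p, of L n] L iso_same_card[of G L] o
    by (simp add: finite_group_def order_def)
qed

end

section \<open>Lifting subgroups of the class along epimorphisms\<close>

context complete_group_class
begin

text \<open>
  Induction on the order of \<open>G\<close>. Let \<open>P\<close> be a nontrivial Sylow \<open>p\<close>-subgroup of the kernel. If its
  normalizer is a proper subgroup, then by the Frattini argument it still maps onto \<open>Q\<close>. Otherwise
  the centre \<open>Z\<close> of \<open>P\<close> is a nontrivial abelian normal subgroup of \<open>G\<close>, and the induction
  hypothesis for the quotient by \<open>Z\<close> provides an extension \<open>H\<close> of an \<open>\<XX>\<close>-group by \<open>Z\<close> that maps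
  onto \<open>Q\<close>. If \<open>p\<close> divides the order of a member of the class, then \<open>Z\<close> and \<open>H\<close> are in the class;
  otherwise \<open>Z\<close> has a complement in \<open>H\<close>.
\<close>
lemma X_subgroup_lift_nat:
  fixes G :: "nat monoid"
  assumes "finite (carrier G)" "group_hom G Q f" "f ` carrier G = carrier Q" "in_class \<XX> Q"
  shows "\<exists>H. X_subgroup \<XX> G H \<and> f ` H = carrier Q"
  using assms(1-3)
proof (induction "card (carrier G)" arbitrary: G f rule: less_induct)
  case less
  interpret f: group_hom G Q f by (rule less.prems)
  note fin = less.prems(1) and surj = less.prems(3)
  let ?N = "kernel G Q f"
  have N: "?N \<lhd> G" and sN: "subgroup ?N G"
    by (rule f.normal_kernel, rule f.subgroup_kernel)
  have finN: "finite ?N" using fin by (simp add: kernel_def)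
  have gN: "group (G\<lparr>carrier := ?N\<rparr>)" by (rule f.G.subgroup_imp_group[OF sN])
  show ?case
  proof (cases "in_class \<XX> (G\<lparr>carrier := ?N\<rparr>)")
    case True
    then have "in_class \<XX> G"
      by (rule in_class_extension[OF less.prems(2) surj fin assms(4)])
    then show ?thesis
      using surj f.G.subgroup_self by (auto simp: X_subgroup_def)
  next
    case False
    have "card ?N \<noteq> 1"
    proof
      assume "card ?N = 1"
      then have "?N = {\<one>\<^bsub>G\<^esub>}"
        using subgroup.one_closed[OF sN] by (metis card_1_singletonE singletonD)
      then show False
        using in_class_trivial[OF gN] False by simp
    qed
    then obtain p where p: "Factorial_Ring.prime p" "p dvd card ?N"
      using prime_factor_nat by blast
    have N0: "card ?N \<noteq> 0"
      using finN subgroup.one_closed[OF sN] by auto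
    define a where "a = multiplicity p (card ?N)"
    obtain m where m: "card ?N = p ^ a * m" "\<not> p dvd m"
      using multiplicity_decompose'[of "card ?N" p] N0 p(1) not_prime_unit unfolding a_def by blast
    have a: "a > 0"
      using m p by (cases a) auto
    obtain P where P': "subgroup P (G\<lparr>carrier := ?N\<rparr>)" and cP: "card P = p ^ a"
      using sylow_thm[OF p(1) gN, of a m] m(1) finN by (auto simp: order_def)
    have PN: "P \<subseteq> ?N" using subgroup.subset[OF P'] by simp
    have P: "subgroup P G" by (rule f.G.incl_subgroup[OF sN P'])
    have PG: "P \<subseteq> carrier G" by (rule subgroup.subset[OF P])
    let ?Y = "normalizer G P"
    have Y: "subgroup ?Y G" by (rule f.G.normalizer_imp_subgroup[OF PG])
    show ?thesis
    proof (cases "?Y = carrier G")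
      case False
      let ?GY = "G\<lparr>carrier := ?Y\<rparr>"
      have YG: "?Y \<subseteq> carrier G" by (rule subgroup.subset[OF Y])
      have "card (carrier ?GY) < card (carrier G)"
        using psubset_card_mono[OF fin] YG False by auto
      moreover have "group_hom ?GY Q f"
        by (rule f.induced_group_hom'[OF Y])
      moreover have "f ` carrier ?GY = carrier Q"
      proof -
        have "f g \<in> f ` ?Y" if g: "g \<in> carrier G" for g
        proof -
          obtain n where n: "n \<in> ?N" "n \<otimes>\<^bsub>G\<^esub> g \<in> ?Y"
            using f.G.frattini[OF fin N P PN p(1) cP m g] by blast
          then have "f (n \<otimes>\<^bsub>G\<^esub> g) = f g"
            using g by (simp add: kernel_def)
          then show ?thesis using n(2) by (metis imageI)
        qed
        then have "f ` carrier G \<subseteq> f ` ?Y" by blast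
        moreover have "f ` ?Y \<subseteq> f ` carrier G" using YG by blast
        ultimately show ?thesis using surj by simp
      qed
      ultimately obtain H where "X_subgroup \<XX> ?GY H" "f ` H = carrier Q"
        using less.hyps[of ?GY f] finite_subset[OF YG fin] by auto
      then show ?thesis
        using X_subgroup_trans[OF f.G.is_group Y] by blast
    next
      case True
      have nP: "P \<lhd> G"
        using f.G.subgroup_in_normalizer[OF P] True by simp
      let ?Z = "center (G\<lparr>carrier := P\<rparr>)"
      have Z: "?Z \<lhd> G" by (rule f.G.center_of_normal[OF nP])
      have sZ: "subgroup ?Z G" by (rule normal_imp_subgroup[OF Z])
      have ZP: "?Z \<subseteq> P" by (auto simp: center_def)
      obtain k where k: "k > 0" "card ?Z = p ^ k"
        using group.card_center_p_group[OF f.G.subgroup_imp_group[OF P] p(1) _ a] cP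
        by (auto simp: order_def)
      have "finite_group G" using fin by (simp add: finite_group_def)
      then obtain L :: "nat monoid" and q where
        q: "group_hom G L q" "q ` carrier G = carrier L" "kernel G L q = ?Z"
        using quotient_nat_copy[OF _ Z] by blast
      interpret q: group_hom G L q by (rule q(1))
      obtain g where g: "group_hom L Q g" "\<And>x. x \<in> carrier G \<Longrightarrow> g (q x) = f x"
        using epi_factor[OF q(1,2) less.prems(2)] q(3) ZP PN by blast
      have "finite (carrier L)"
        using fin q(2) by (metis finite_imageI)
      moreover have "card (carrier L) < card (carrier G)"
      proof -
        have "card (carrier G) = card (carrier L) * p ^ k"
          using epi_card[OF q(1,2)] q(3) k(2) by simp
        moreover have "1 < p ^ k"
          using one_less_power[OF prime_gt_1_nat[OF p(1)] k(1)] .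
        moreover have "0 < card (carrier L)"
          using \<open>finite (carrier L)\<close> q.H.one_closed by (auto simp: card_gt_0_iff)
        ultimately show ?thesis by simp
      qed
      moreover have "g ` carrier L = carrier Q"
        using g(2) surj by (simp add: image_image flip: q(2))
      ultimately obtain K where K: "X_subgroup \<XX> L K" "g ` K = carrier Q"
        using less.hyps[of L g] g(1) by blast
      have sK: "subgroup K L" and cK: "in_class \<XX> (L\<lparr>carrier := K\<rparr>)"
        using K(1) by (auto simp: X_subgroup_def)
      define H where "H = {x \<in> carrier G. q x \<in> K}"
      have sH: "subgroup H G"
        unfolding H_def by (rule q.subgroup_preimage[OF sK])
      have HG: "H \<subseteq> carrier G" by (auto simp: H_def)
      have qH: "q ` H = K"
        using q(2) subgroup.subset[OF sK] by (auto simp: H_def)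
      have f_image: "f ` C = carrier Q" if "q ` C = K" "C \<subseteq> carrier G" for C
      proof -
        have "f ` C = (\<lambda>x. g (q x)) ` C"
          by (rule image_cong) (use that(2) g(2) in auto)
        then show ?thesis
          using that(1) K(2) by (simp flip: image_image)
      qed
      have memZ: "x \<in> ?Z \<longleftrightarrow> x \<in> carrier G \<and> q x = \<one>\<^bsub>L\<^esub>" for x
        unfolding q(3)[symmetric] kernel_def by simp
      have ZH: "?Z \<subseteq> H"
        using memZ subgroup.one_closed[OF sK] by (auto simp: H_def)
      show ?thesis
      proof (cases "class_prime p")
        case True
        have "in_class \<XX> (G\<lparr>carrier := ?Z\<rparr>)"
          using in_class_p_group[OF True f.G.subgroup_imp_group[OF sZ], of k] k(2) by (simp add: order_def)
        moreover have "H \<inter> kernel G L q = ?Z"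
          using ZH q(3) by blast
        ultimately have "X_subgroup \<XX> G H"
          using X_subgroup_extension[OF q(1) fin sH] cK qH by simp
        then show ?thesis using f_image[OF qH HG] by blast
      next
        case False
        let ?GH = "G\<lparr>carrier := H\<rparr>"
        interpret GH: group ?GH by (rule f.G.subgroup_imp_group[OF sH])
        have hom: "group_hom ?GH (L\<lparr>carrier := K\<rparr>) q"
          using q.induced_group_hom[OF sH] qH by simp
        have ker: "kernel ?GH (L\<lparr>carrier := K\<rparr>) q = ?Z"
          using memZ ZH HG by (auto simp: kernel_def)
        have nZ: "?Z \<lhd> ?GH"
          using group_hom.normal_kernel[OF hom] ker by simp
        have Zp: "0 < card ?Z"
          using k p(1) by (simp add: prime_gt_0_nat)
        have "card (carrier ?GH) = card K * card ?Z"
          using epi_card[OF hom] ker qH by simp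
        then have "card (rcosets\<^bsub>?GH\<^esub> ?Z) = card K"
          using GH.lagrange[OF normal_imp_subgroup[OF nZ]] Zp by (simp add: order_def)
        moreover have "coprime (card K) (card ?Z)"
        proof -
          have "\<not> p dvd card K"
            using class_primeI[OF p(1) cK] False by auto
          then show ?thesis
            using prime_imp_coprime[OF p(1)] k(2) coprime_commute by auto
        qed
        ultimately have cop: "coprime (card (rcosets\<^bsub>?GH\<^esub> ?Z)) (card ?Z)" by simp
        have comm: "x \<otimes>\<^bsub>?GH\<^esub> y = y \<otimes>\<^bsub>?GH\<^esub> x" if "x \<in> ?Z" "y \<in> ?Z" for x y
        proof -
          have "\<forall>g\<in>P. g \<otimes>\<^bsub>G\<^esub> y = y \<otimes>\<^bsub>G\<^esub> g"
            using that(2) by (simp add: center_def)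
          then show ?thesis
            using that(1) ZP by auto
        qed
        have finH: "finite (carrier ?GH)"
          using finite_subset[OF HG fin] by simp
        from GH.abelian_normal_coprime_complement[OF finH nZ comm cop]
        obtain C where C: "subgroup C ?GH" "C \<inter> ?Z = {\<one>\<^bsub>G\<^esub>}"
          and CZ: "\<And>x. x \<in> H \<Longrightarrow> \<exists>z\<in>?Z. z \<otimes>\<^bsub>G\<^esub> x \<in> C"
          by auto
        have sC: "subgroup C G" by (rule f.G.incl_subgroup[OF sH C(1)])
        have CH: "C \<subseteq> H" using subgroup.subset[OF C(1)] by simp
        have qC: "q ` C = K"
        proof -
          have "q x \<in> q ` C" if x: "x \<in> H" for x
          proof -
            obtain z where z: "z \<in> ?Z" "z \<otimes>\<^bsub>G\<^esub> x \<in> C" using CZ[OF x] by blast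
            then have "q (z \<otimes>\<^bsub>G\<^esub> x) = q x"
              using x HG memZ by auto
            then show ?thesis using z(2) by (metis imageI)
          qed
          then show ?thesis using qH CH by blast
        qed
        have "X_subgroup \<XX> G C"
          using X_subgroup_extension[OF q(1) fin sC] cK q(3) C(2) qC
            in_class_trivial[OF f.G.subgroup_imp_group[OF f.G.triv_subgroup]] by simp
        then show ?thesis
          using f_image[OF qC] CH HG by auto
      qed
    qed
  qed
qed

lemma X_subgroup_lift:
  assumes fin: "finite (carrier G)" and f: "group_hom G H f" and surj: "f ` carrier G = carrier H"
    and K: "X_subgroup \<XX> H K"
  shows "\<exists>L. X_subgroup \<XX> G L \<and> f ` L = K"
proof -
  interpret f: group_hom G H f by (rule f)
  have sK: "subgroup K H" and cK: "in_class \<XX> (H\<lparr>carrier := K\<rparr>)"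
    using K by (auto simp: X_subgroup_def)
  define Y where "Y = {x \<in> carrier G. f x \<in> K}"
  let ?GY = "G\<lparr>carrier := Y\<rparr>" and ?HK = "H\<lparr>carrier := K\<rparr>"
  have Y: "subgroup Y G"
    unfolding Y_def by (rule f.subgroup_preimage[OF sK])
  have fY: "f ` Y = K"
    using surj subgroup.subset[OF sK] by (auto simp: Y_def)
  have gY: "group ?GY" by (rule f.G.subgroup_imp_group[OF Y])
  have gK: "group ?HK" by (rule f.H.subgroup_imp_group[OF sK])
  have "finite_group ?GY"
    using gY fin by (simp add: finite_group_def Y_def)
  then obtain N :: "nat monoid" and h where N: "finite_group N" and h: "h \<in> iso ?GY N"
    by (rule nat_copy)
  have gN: "group N" and finN: "finite (carrier N)" using N by (auto simp: finite_group_def)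
  let ?i = "inv_into (carrier ?GY) h"
  have i: "?i \<in> iso N ?GY" by (rule group.iso_set_sym[OF gY h])
  then have hi: "group_hom N ?GY ?i"
    using gN gY by (simp add: group_hom_def group_hom_axioms_def iso_imp_homomorphism)
  have "f \<in> epi ?GY ?HK"
    using epi_iff_group_hom[OF gY gK] f.induced_group_hom[OF Y] fY by simp
  then have "f \<circ> ?i \<in> epi N ?HK"
    using i by (meson epi_compose iso_iff_mon_epi)
  then have "group_hom N ?HK (f \<circ> ?i)" "(f \<circ> ?i) ` carrier N = carrier ?HK"
    using epi_iff_group_hom[OF gN gK] by blast+
  from X_subgroup_lift_nat[OF finN this cK]
  obtain S where S: "X_subgroup \<XX> N S" "(f \<circ> ?i) ` S = K"
    by auto
  have "X_subgroup \<XX> G (?i ` S)"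
    using X_subgroup_trans[OF f.G.is_group Y X_subgroup_image[OF hi S(1)]] .
  then show ?thesis
    using S(2) by (metis image_comp)
qed

end

section \<open>Products with normal subgroups and conjugate subgroups\<close>

lemma (in group_hom) card_image_mult_kernel:
  assumes K: "subgroup K G"
  shows "card K = card (h ` K) * card (K \<inter> kernel G H h)"
proof -
  have "kernel (G\<lparr>carrier := K\<rparr>) (H\<lparr>carrier := h ` K\<rparr>) h = K \<inter> kernel G H h"
    using subgroup.subset[OF K] by (auto simp: kernel_def)
  then show ?thesis
    using epi_card[OF induced_group_hom[OF K]] by simp
qed

lemma (in group_hom) image_subset_iff_set_mult:
  assumes A: "A \<subseteq> carrier G" and B: "B \<subseteq> carrier G"
  shows "h ` A \<subseteq> h ` B \<longleftrightarrow> A \<subseteq> kernel G H h <#> B"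
proof
  assume *: "h ` A \<subseteq> h ` B"
  show "A \<subseteq> kernel G H h <#> B"
  proof
    fix a assume a: "a \<in> A"
    then obtain b where b: "b \<in> B" "h a = h b" using * by blast
    have ab: "a \<in> carrier G" "b \<in> carrier G" using a b A B by auto
    then have "a \<otimes> inv b \<in> kernel G H h" using b(2) eq_iff_kernel by blast
    moreover have "a = (a \<otimes> inv b) \<otimes> b" using ab by (simp add: G.m_assoc)
    ultimately show "a \<in> kernel G H h <#> B" using b(1) by (auto simp: set_mult_def)
  qed
next
  assume *: "A \<subseteq> kernel G H h <#> B"
  show "h ` A \<subseteq> h ` B"
  proof clarify
    fix a assume "a \<in> A"
    then obtain n b where nb: "n \<in> kernel G H h" "b \<in> B" "a = n \<otimes> b"
      using * by (fastforce simp: set_mult_def)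
    then have "h a = h b" using B by (auto simp: kernel_def)
    then show "h a \<in> h ` B" using nb(2) by blast
  qed
qed

context group
begin

lemma subgroup_card_dvd:
  assumes "subgroup A G" "subgroup B G" "A \<subseteq> B"
  shows "card A dvd card B"
  using group.lagrange[OF subgroup_imp_group[OF assms(2)] subgroup_incl[OF assms]]
  by (metis dvd_triv_right order_def partial_object.select_convs(1) partial_object.update_convs(1)
      partial_object.surjective)

lemma subgroup_set_mult:
  assumes N: "N \<lhd> G" and S: "subgroup S G"
  shows "subgroup (N <#> S) G"
proof -
  interpret second_isomorphism_grp N G S
    using N S by (simp add: second_isomorphism_grp_def second_isomorphism_grp_axioms_def)
  show ?thesis by (rule normal_set_mult_subgroup)
qed

lemma subset_set_mult:
  assumes N: "N \<lhd> G" and S: "subgroup S G"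
  shows "S \<subseteq> N <#> S" "N \<subseteq> N <#> S"
proof -
  have one: "\<one> \<in> N" "\<one> \<in> S"
    using subgroup.one_closed[OF normal_imp_subgroup[OF N]] subgroup.one_closed[OF S] by auto
  show "S \<subseteq> N <#> S"
  proof
    fix s assume s: "s \<in> S"
    then have "s = \<one> \<otimes> s" using subgroup.mem_carrier[OF S] by simp
    then show "s \<in> N <#> S" using s one unfolding set_mult_def by blast
  qed
  show "N \<subseteq> N <#> S"
  proof
    fix n assume n: "n \<in> N"
    then have "n = n \<otimes> \<one>" using subgroup.mem_carrier[OF normal_imp_subgroup[OF N]] by simp
    then show "n \<in> N <#> S" using n one unfolding set_mult_def by blast
  qed
qed

lemma set_mult_least:
  assumes "subgroup T G" "N \<subseteq> T" "S \<subseteq> T"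
  shows "N <#> S \<subseteq> T"
  using assms subgroup.m_closed[OF assms(1)] by (auto simp: set_mult_def)

lemma conj_image_set_mult:
  assumes N: "N \<lhd> G" and S: "S \<subseteq> carrier G" and g: "g \<in> carrier G"
  shows "conj_by g ` (N <#> S) = N <#> conj_by g ` S"
proof -
  interpret c: group_hom G G "conj_by g" by (rule group_hom_conj[OF g])
  have NG: "N \<subseteq> carrier G" using subgroup.subset[OF normal_imp_subgroup[OF N]] .
  have "conj_by g ` N = N"
  proof
    show "conj_by g ` N \<subseteq> N" by (rule normal_conj_image[OF N g order_refl])
    have "conj_by g ` conj_by (inv g) ` N \<subseteq> conj_by g ` N"
      using normal_conj_image[OF N _ order_refl, of "inv g"] g by (intro image_mono) simp
    then show "N \<subseteq> conj_by g ` N" using conj_image_inv(2)[OF g NG] by simp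
  qed
  then show ?thesis
    using set_mult_hom[OF c.homh NG S] by simp
qed

lemma normal_set_mult:
  assumes N: "N \<lhd> G" and M: "M \<lhd> G"
  shows "N <#> M \<lhd> G"
proof -
  have MG: "M \<subseteq> carrier G" using subgroup.subset[OF normal_imp_subgroup[OF M]] .
  have "g \<otimes> x \<otimes> inv g \<in> N <#> M" if g: "g \<in> carrier G" and x: "x \<in> N <#> M" for g x
  proof -
    have "conj_by g ` (N <#> M) \<subseteq> N <#> M"
      using conj_image_set_mult[OF N MG g] normal_conj_image[OF M g order_refl]
      by (simp add: mono_set_mult)
    then show ?thesis using x by (auto simp: conj_by_def)
  qed
  then show ?thesis
    using subgroup_set_mult[OF N normal_imp_subgroup[OF M]] by (simp add: normal_inv_iff)
qed

lemma conjugate_sets_iff: "conjugate_sets G H K \<longleftrightarrow> (\<exists>g\<in>carrier G. K = conj_by g ` H)"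
  by (simp add: conjugate_sets_def conj_coset)

lemma conjugate_sets_refl: "H \<subseteq> carrier G \<Longrightarrow> conjugate_sets G H H"
  using conj_image_one[of H] by (auto simp: conjugate_sets_iff intro!: bexI[of _ \<one>])

lemma conjugate_sets_sym:
  assumes "H \<subseteq> carrier G" "conjugate_sets G H K"
  shows "conjugate_sets G K H"
proof -
  obtain g where g: "g \<in> carrier G" "K = conj_by g ` H"
    using assms(2) by (auto simp: conjugate_sets_iff)
  then have "H = conj_by (inv g) ` K"
    using conj_image_inv(1)[OF g(1) assms(1)] by simp
  then show ?thesis using g(1) unfolding conjugate_sets_iff by blast
qed

lemma conjugate_sets_trans:
  assumes "H \<subseteq> carrier G" "conjugate_sets G H K" "conjugate_sets G K L"
  shows "conjugate_sets G H L"
proof -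
  obtain g h where "g \<in> carrier G" "K = conj_by g ` H" "h \<in> carrier G" "L = conj_by h ` K"
    using assms(2,3) by (auto simp: conjugate_sets_iff)
  then have "L = conj_by (h \<otimes> g) ` H" "h \<otimes> g \<in> carrier G"
    using conj_image_mult[of h g H] assms(1) by auto
  then show ?thesis unfolding conjugate_sets_iff by blast
qed

end

section \<open>Reducing normal subgroups\<close>

lemma X_maximals_iff:
  "H \<in> X_maximals \<XX> G \<longleftrightarrow>
     X_subgroup \<XX> G H \<and> (\<forall>K. X_subgroup \<XX> G K \<and> H \<subseteq> K \<longrightarrow> K = H)"
  by (auto simp: X_maximals_def X_subgroup_def)

lemma X_maximals_subset: "H \<in> X_maximals \<XX> G \<Longrightarrow> H \<subseteq> carrier G"
  by (simp add: X_maximals_def subgroup.subset)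

text \<open>
  The condition says that the projection to \<open>G Mod N\<close> is an isoschematism, in a form that mentions
  neither quotients nor schemes.
\<close>
definition reducing :: "nat monoid set \<Rightarrow> ('a, 'b) monoid_scheme \<Rightarrow> 'a set \<Rightarrow> bool" where
  "reducing \<XX> G N \<longleftrightarrow> N \<lhd> G \<and>
     (\<forall>A\<in>X_maximals \<XX> G. \<forall>B\<in>X_maximals \<XX> G. A \<subseteq> N <#>\<^bsub>G\<^esub> B \<longrightarrow> conjugate_sets G A B)"

context complete_group_class
begin

lemma X_subgroup_extends:
  assumes fin: "finite (carrier G)" and H: "X_subgroup \<XX> G H"
  shows "\<exists>M\<in>X_maximals \<XX> G. H \<subseteq> M"
proof -
  let ?A = "{K. X_subgroup \<XX> G K \<and> H \<subseteq> K}"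
  have "?A \<subseteq> Pow (carrier G)"
    using subgroup.subset by (auto simp: X_subgroup_def)
  then have "finite ?A"
    using fin by (meson finite_Pow_iff finite_subset)
  moreover have "H \<in> ?A" using H by simp
  ultimately obtain M where "M \<in> ?A" "\<forall>K\<in>?A. M \<subseteq> K \<longrightarrow> M = K"
    using finite_has_maximal2[of ?A H] by auto
  then have "M \<in> X_maximals \<XX> G" "H \<subseteq> M"
    unfolding X_maximals_iff by blast+
  then show ?thesis by blast
qed

lemma X_maximals_conj:
  assumes G: "group G" and H: "H \<in> X_maximals \<XX> G" and g: "g \<in> carrier G"
  shows "group.conj_by G g ` H \<in> X_maximals \<XX> G"
proof -
  interpret group G by fact
  have X: "X_subgroup \<XX> G H" using H by (simp add: X_maximals_iff)
  have HG: "H \<subseteq> carrier G" by (rule X_maximals_subset[OF H])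
  have "X_subgroup \<XX> G (conj_by g ` H)"
    by (rule X_subgroup_image[OF group_hom_conj[OF g] X])
  moreover have "K = conj_by g ` H" if K: "X_subgroup \<XX> G K" "conj_by g ` H \<subseteq> K" for K
  proof -
    have KG: "K \<subseteq> carrier G" using K(1) subgroup.subset by (auto simp: X_subgroup_def)
    have "X_subgroup \<XX> G (conj_by (inv\<^bsub>G\<^esub> g) ` K)"
      by (rule X_subgroup_image[OF group_hom_conj K(1)]) (simp add: g)
    moreover have "H \<subseteq> conj_by (inv\<^bsub>G\<^esub> g) ` K"
      using image_mono[OF K(2), of "conj_by (inv\<^bsub>G\<^esub> g)"] conj_image_inv(1)[OF g HG] by simp
    ultimately have "conj_by (inv\<^bsub>G\<^esub> g) ` K = H"
      using H by (auto simp: X_maximals_iff)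
    then show ?thesis
      using conj_image_inv(2)[OF g KG] by simp
  qed
  ultimately show ?thesis by (auto simp: X_maximals_iff)
qed

text \<open>
  The normalizer of a Sylow \<open>p\<close>-subgroup \<open>P\<close> of \<open>M\<close> covers \<open>G\<close> modulo \<open>M\<close>, so it contains an
  \<open>\<XX>\<close>-subgroup with the same image as \<open>K\<close>, and multiplying by the \<open>p\<close>-group \<open>P\<close> does not leave the
  class. A maximal subgroup that contains the product is conjugate to \<open>K\<close>, and it contains \<open>P\<close>.
\<close>
lemma reducing_hall:
  assumes fin: "finite (carrier G)" and M: "reducing \<XX> G M" and K: "K \<in> X_maximals \<XX> G"
    and p: "class_prime p" and q: "card M = card (M \<inter> K) * q"
  shows "\<not> p dvd q"
proof -
  have nM: "M \<lhd> G" using M by (simp add: reducing_def)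
  interpret M: normal M G by (rule nM)
  have sM: "subgroup M G" by (rule M.subgroup_axioms)
  have gM: "group (G\<lparr>carrier := M\<rparr>)" by (rule M.subgroup_imp_group[OF sM])
  have pr: "Factorial_Ring.prime p" using p by (simp add: class_prime_def)
  have finM: "finite M" using finite_subset[OF M.subset fin] .
  have M0: "card M \<noteq> 0" using finM subgroup.one_closed[OF sM] by (metis card_0_eq empty_iff)
  define a where "a = multiplicity p (card M)"
  obtain m where m: "card M = p ^ a * m" "\<not> p dvd m"
    using multiplicity_decompose'[of "card M" p] M0 pr not_prime_unit unfolding a_def by blast
  obtain P where P': "subgroup P (G\<lparr>carrier := M\<rparr>)" and cP: "card P = p ^ a"
    using sylow_thm[OF pr gM, of a m] m(1) finM by (auto simp: order_def)
  have PM: "P \<subseteq> M" using subgroup.subset[OF P'] by simp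
  have P: "subgroup P G" by (rule M.incl_subgroup[OF sM P'])
  have PG: "P \<subseteq> carrier G" by (rule subgroup.subset[OF P])
  let ?Y = "normalizer G P"
  let ?GY = "G\<lparr>carrier := ?Y\<rparr>"
  let ?f = "\<lambda>x. M #>\<^bsub>G\<^esub> x"
  have Y: "subgroup ?Y G" by (rule M.normalizer_imp_subgroup[OF PG])
  have YG: "?Y \<subseteq> carrier G" by (rule subgroup.subset[OF Y])
  have gY: "group ?GY" by (rule M.subgroup_imp_group[OF Y])
  have finY: "finite (carrier ?GY)" using finite_subset[OF YG fin] by simp
  interpret f: group_hom G "G Mod M" ?f by (rule normal_projection(1)[OF nM])
  have ker: "kernel G (G Mod M) ?f = M" by (rule normal_projection(3)[OF nM])
  have surj: "?f ` carrier ?GY = carrier (G Mod M)"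
  proof -
    have "?f g \<in> ?f ` ?Y" if g: "g \<in> carrier G" for g
    proof -
      obtain n where n: "n \<in> M" "n \<otimes>\<^bsub>G\<^esub> g \<in> ?Y"
        using M.frattini[OF fin nM P PM pr cP m g] by blast
      then have "n \<otimes>\<^bsub>G\<^esub> g \<otimes>\<^bsub>G\<^esub> inv\<^bsub>G\<^esub> g \<in> kernel G (G Mod M) ?f"
        using g ker by (simp add: M.m_assoc)
      then have "?f (n \<otimes>\<^bsub>G\<^esub> g) = ?f g"
        using f.eq_iff_kernel[of "n \<otimes>\<^bsub>G\<^esub> g" g] g n(1) by simp
      then show ?thesis using n(2) by (metis imageI)
    qed
    then have "?f ` carrier G \<subseteq> ?f ` ?Y" by blast
    moreover have "?f ` ?Y \<subseteq> ?f ` carrier G" using YG by blast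
    ultimately show ?thesis using normal_projection(2)[OF nM] by simp
  qed
  have XK: "X_subgroup \<XX> G K" using K by (simp add: X_maximals_iff)
  obtain L0 where L0: "X_subgroup \<XX> ?GY L0" "?f ` L0 = ?f ` K"
    using X_subgroup_lift[OF finY f.induced_group_hom'[OF Y] surj X_subgroup_image[OF f.group_hom_axioms XK]] by blast
  have sL0: "subgroup L0 ?GY" using L0(1) by (simp add: X_subgroup_def)
  have nP: "P \<lhd> ?GY" by (rule M.subgroup_in_normalizer[OF P])
  let ?r = "\<lambda>x. P #>\<^bsub>?GY\<^esub> x"
  interpret r: group_hom ?GY "?GY Mod P" ?r by (rule normal_projection(1)[OF nP])
  have kr: "kernel ?GY (?GY Mod P) ?r = P" by (rule normal_projection(3)[OF nP])
  have Xr: "X_subgroup \<XX> (?GY Mod P) (?r ` L0)"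
    by (rule X_subgroup_image[OF r.group_hom_axioms L0(1)])
  define L where "L = {x \<in> carrier ?GY. ?r x \<in> ?r ` L0}"
  have sL: "subgroup L ?GY"
    unfolding L_def by (rule r.subgroup_preimage) (use Xr in \<open>simp add: X_subgroup_def\<close>)
  have L0L: "L0 \<subseteq> L"
    using subgroup.subset[OF sL0] by (auto simp: L_def)
  have rL: "?r ` L = ?r ` L0"
    using L0L by (auto simp: L_def)
  have PL: "P \<subseteq> L"
  proof
    fix x assume x: "x \<in> P"
    then have "x \<in> kernel ?GY (?GY Mod P) ?r" using kr by simp
    then have "x \<in> carrier ?GY" "?r x = ?r \<one>\<^bsub>?GY\<^esub>"
      using r.hom_one unfolding kernel_def by auto
    then show "x \<in> L"
      using subgroup.one_closed[OF sL0] by (auto simp: L_def)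
  qed
  have "X_subgroup \<XX> ?GY L"
  proof (rule X_subgroup_extension[OF r.group_hom_axioms finY sL])
    show "in_class \<XX> ((?GY Mod P)\<lparr>carrier := ?r ` L\<rparr>)"
      using Xr rL by (simp add: X_subgroup_def)
    have "in_class \<XX> (G\<lparr>carrier := P\<rparr>)"
      using in_class_p_group[OF p M.subgroup_imp_group[OF P], of a] cP by (simp add: order_def)
    moreover have "L \<inter> kernel ?GY (?GY Mod P) ?r = P"
      using kr PL by blast
    ultimately show "in_class \<XX> (?GY\<lparr>carrier := L \<inter> kernel ?GY (?GY Mod P) ?r\<rparr>)"
      by simp
  qed
  then have "X_subgroup \<XX> G L" by (rule X_subgroup_trans[OF M.is_group Y])
  then obtain L' where L': "L' \<in> X_maximals \<XX> G" "L \<subseteq> L'"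
    using X_subgroup_extends[OF fin] by blast
  have "?f ` K \<subseteq> ?f ` L'"
    using L0(2) L0L L'(2) by (metis image_mono order_trans)
  then have "K \<subseteq> M <#>\<^bsub>G\<^esub> L'"
    using f.image_subset_iff_set_mult[OF X_maximals_subset[OF K] X_maximals_subset[OF L'(1)]] ker by simp
  then have "conjugate_sets G K L'"
    using M K L'(1) by (simp add: reducing_def)
  then obtain g where g: "g \<in> carrier G" "L' = M.conj_by g ` K"
    by (auto simp: M.conjugate_sets_iff)
  have KG: "K \<subseteq> carrier G" by (rule X_maximals_subset[OF K])
  have "M \<inter> L' \<subseteq> M.conj_by g ` (M \<inter> K)"
  proof
    fix x assume x: "x \<in> M \<inter> L'"
    then obtain k where k: "k \<in> K" "x = M.conj_by g k" using g by blast
    then have "k = M.conj_by (inv\<^bsub>G\<^esub> g) x"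
      using M.conj_mult[of "inv\<^bsub>G\<^esub> g" g k] g KG by auto
    then have "k \<in> M"
      using M.normal_conj_image[OF nM, of "inv\<^bsub>G\<^esub> g" M] g x by auto
    then show "x \<in> M.conj_by g ` (M \<inter> K)" using k by blast
  qed
  moreover have "M.conj_by g ` (M \<inter> K) \<subseteq> M \<inter> L'"
    using M.normal_conj_image[OF nM g(1), of "M \<inter> K"] g(2) by blast
  ultimately have "card (M \<inter> L') = card (M \<inter> K)"
    using M.card_conj_image[OF g(1), of "M \<inter> K"] M.subset by (metis Int_lower1 order_trans subset_antisym)
  moreover have "card P dvd card (M \<inter> L')"
  proof (rule M.subgroup_card_dvd[OF P])
    show "subgroup (M \<inter> L') G"
      using M.subgroups_Inter_pair[OF sM] L'(1) by (simp add: X_maximals_def)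
  qed (use PM PL L'(2) in blast)
  ultimately obtain c where "card (M \<inter> K) = p ^ a * c"
    using cP by (metis dvdE)
  then have "p ^ a * m = p ^ a * (c * q)"
    using q m(1) by (metis mult.assoc)
  then have "m = c * q"
    using prime_gt_0_nat[OF pr] by simp
  then show ?thesis using m(2) by auto
qed

lemma X_subgroup_subdirect:
  assumes fin: "finite (carrier G)" and f: "group_hom G A f" and g: "group_hom G B g"
    and E: "subgroup E G" and fE: "X_subgroup \<XX> A (f ` E)" and gE: "X_subgroup \<XX> B (g ` E)"
    and ker: "kernel G A f \<inter> kernel G B g \<subseteq> {\<one>\<^bsub>G\<^esub>}"
  shows "X_subgroup \<XX> G E"
proof -
  interpret f: group_hom G A f by fact
  interpret g: group_hom G B g by fact
  let ?F = "E \<inter> kernel G A f"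
  have F: "subgroup ?F G"
    by (rule f.G.subgroups_Inter_pair[OF E f.subgroup_kernel])
  have "?F \<inter> kernel G B g = {\<one>\<^bsub>G\<^esub>}"
    using ker subgroup.one_closed[OF F] subgroup.one_closed[OF g.subgroup_kernel] by blast
  moreover have "in_class \<XX> (G\<lparr>carrier := {\<one>\<^bsub>G\<^esub>}\<rparr>)"
    by (rule in_class_trivial[OF f.G.subgroup_imp_group[OF f.G.triv_subgroup]]) simp
  moreover have "X_subgroup \<XX> B (g ` ?F)"
    by (rule X_subgroup_mono[OF g.H.is_group gE g.subgroup_img_is_subgroup[OF F]]) blast
  ultimately have "X_subgroup \<XX> G ?F"
    using X_subgroup_extension[OF g fin F] by (simp add: X_subgroup_def)
  then show ?thesis
    using X_subgroup_extension[OF f fin E] fE by (simp add: X_subgroup_def)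
qed

text \<open>
  Modulo \<open>N \<inter> M\<close> the group \<open>E\<close> embeds into the product of the images of \<open>D\<close> and \<open>H\<close>.
\<close>
lemma X_subgroup_lift_subdirect:
  assumes fin: "finite (carrier G)" and N: "N \<lhd> G" and M: "M \<lhd> G" and E: "subgroup E G"
    and D: "X_subgroup \<XX> G D" and ED: "E \<subseteq> N <#>\<^bsub>G\<^esub> D"
    and H: "X_subgroup \<XX> G H" and EH: "E \<subseteq> M <#>\<^bsub>G\<^esub> H"
  shows "\<exists>L. X_subgroup \<XX> G L \<and> E \<subseteq> (N \<inter> M) <#>\<^bsub>G\<^esub> L"
proof -
  let ?I = "N \<inter> M"
  have G: "group G" using N by (simp add: normal_def)
  interpret group G by fact
  have I: "?I \<lhd> G" by (rule normal_subgroup_intersect[OF N M])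
  have sub: "A \<subseteq> carrier G" if "X_subgroup \<XX> G A" for A
    using that subgroup.subset by (auto simp: X_subgroup_def)
  let ?p = "\<lambda>x. ?I #>\<^bsub>G\<^esub> x" and ?Q = "G Mod ?I"
  note p = normal_projection[OF I] and n = normal_projection[OF N] and m = normal_projection[OF M]
  have EG: "E \<subseteq> carrier G" by (rule subgroup.subset[OF E])
  interpret p: group_hom G ?Q ?p by (rule p(1))
  interpret n: group_hom G "G Mod N" "\<lambda>x. N #>\<^bsub>G\<^esub> x" by (rule n(1))
  interpret m: group_hom G "G Mod M" "\<lambda>x. M #>\<^bsub>G\<^esub> x" by (rule m(1))
  obtain f where f: "group_hom ?Q (G Mod N) f" "\<And>x. x \<in> carrier G \<Longrightarrow> f (?p x) = N #>\<^bsub>G\<^esub> x"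
    using epi_factor[OF p(1,2) n(1)] p(3) n(3) by (metis Int_lower1)
  obtain g where g: "group_hom ?Q (G Mod M) g" "\<And>x. x \<in> carrier G \<Longrightarrow> g (?p x) = M #>\<^bsub>G\<^esub> x"
    using epi_factor[OF p(1,2) m(1)] p(3) m(3) by (metis Int_lower2)
  have finQ: "finite (carrier ?Q)" using fin p(2) by (metis finite_imageI)
  have sE: "subgroup (?p ` E) ?Q" by (rule p.subgroup_img_is_subgroup[OF E])
  have "f ` ?p ` E = (\<lambda>x. N #>\<^bsub>G\<^esub> x) ` E"
    unfolding image_image by (rule image_cong) (use f(2) EG in auto)
  moreover have "X_subgroup \<XX> (G Mod N) ((\<lambda>x. N #>\<^bsub>G\<^esub> x) ` E)"
  proof (rule X_subgroup_mono[OF n.H.is_group X_subgroup_image[OF n(1) D] n.subgroup_img_is_subgroup[OF E]])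
    show "(\<lambda>x. N #>\<^bsub>G\<^esub> x) ` E \<subseteq> (\<lambda>x. N #>\<^bsub>G\<^esub> x) ` D"
      using n.image_subset_iff_set_mult[OF EG sub[OF D]] n(3) ED by simp
  qed
  moreover have "g ` ?p ` E = (\<lambda>x. M #>\<^bsub>G\<^esub> x) ` E"
    unfolding image_image by (rule image_cong) (use g(2) EG in auto)
  moreover have "X_subgroup \<XX> (G Mod M) ((\<lambda>x. M #>\<^bsub>G\<^esub> x) ` E)"
  proof (rule X_subgroup_mono[OF m.H.is_group X_subgroup_image[OF m(1) H] m.subgroup_img_is_subgroup[OF E]])
    show "(\<lambda>x. M #>\<^bsub>G\<^esub> x) ` E \<subseteq> (\<lambda>x. M #>\<^bsub>G\<^esub> x) ` H"
      using m.image_subset_iff_set_mult[OF EG sub[OF H]] m(3) EH by simp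
  qed
  moreover have "kernel ?Q (G Mod N) f \<inter> kernel ?Q (G Mod M) g \<subseteq> {\<one>\<^bsub>?Q\<^esub>}"
  proof
    fix y assume y: "y \<in> kernel ?Q (G Mod N) f \<inter> kernel ?Q (G Mod M) g"
    then obtain x where x: "x \<in> carrier G" "y = ?p x"
      using p(2) by (auto simp: kernel_def)
    then have "x \<in> kernel G (G Mod N) (\<lambda>x. N #>\<^bsub>G\<^esub> x)" "x \<in> kernel G (G Mod M) (\<lambda>x. M #>\<^bsub>G\<^esub> x)"
      using y f(2) g(2) unfolding kernel_def by auto
    then have "x \<in> kernel G ?Q ?p" using n(3) m(3) p(3) by simp
    then show "y \<in> {\<one>\<^bsub>?Q\<^esub>}" using x(2) unfolding kernel_def by simp
  qed
  ultimately have "X_subgroup \<XX> ?Q (?p ` E)"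
    using X_subgroup_subdirect[OF finQ f(1) g(1) sE] by simp
  then obtain L where L: "X_subgroup \<XX> G L" "?p ` L = ?p ` E"
    using X_subgroup_lift[OF fin p(1,2)] by blast
  then have "E \<subseteq> ?I <#>\<^bsub>G\<^esub> L"
    using p.image_subset_iff_set_mult[OF EG sub[OF L(1)]] p(3) by simp
  then show ?thesis using L(1) by blast
qed

text \<open>
  The names follow the outline at the beginning, with \<open>L'\<close> for the maximal subgroup \<open>L\<close> there. The
  comparison of the indices of \<open>N D\<close> and \<open>N L'\<close> takes place inside \<open>M\<close>, between \<open>U = N D \<inter> M\<close> and
  \<open>V = N L' \<inter> M\<close>, which have the same intersection with \<open>N\<close>.
\<close>
theorem reducing_set_mult:
  assumes fin: "finite (carrier G)" and N: "reducing \<XX> G N" and M: "reducing \<XX> G M"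
  shows "reducing \<XX> G (N <#>\<^bsub>G\<^esub> M)"
proof -
  have nN: "N \<lhd> G" and nM: "M \<lhd> G" using N M by (auto simp: reducing_def)
  have G: "group G" using nN by (simp add: normal_def)
  interpret group G by fact
  have sN: "subgroup N G" and sM: "subgroup M G" using nN nM normal_imp_subgroup by blast+
  let ?NM = "N <#>\<^bsub>G\<^esub> M"
  have nNM: "?NM \<lhd> G" by (rule normal_set_mult[OF nN nM])
  have "conjugate_sets G H K"
    if H: "H \<in> X_maximals \<XX> G" and K: "K \<in> X_maximals \<XX> G" and HK: "H \<subseteq> ?NM <#>\<^bsub>G\<^esub> K" for H K
  proof -
    have XH: "X_subgroup \<XX> G H" and XK: "X_subgroup \<XX> G K"
      using H K by (auto simp: X_maximals_iff)
    have sH: "subgroup H G" and sK: "subgroup K G"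
      using XH XK by (auto simp: X_subgroup_def)
    note closed = subgroup.mem_carrier[OF sN] subgroup.mem_carrier[OF sM]
      subgroup.mem_carrier[OF sH] subgroup.mem_carrier[OF sK]
    have sNMH: "subgroup (?NM <#>\<^bsub>G\<^esub> H) G" by (rule subgroup_set_mult[OF nNM sH])
    define D where "D = K \<inter> (?NM <#>\<^bsub>G\<^esub> H)"
    have sD: "subgroup D G"
      unfolding D_def by (rule subgroups_Inter_pair[OF sK sNMH])
    have XD: "X_subgroup \<XX> G D"
      by (rule X_subgroup_mono[OF G XK sD]) (simp add: D_def)
    define ND where "ND = N <#>\<^bsub>G\<^esub> D"
    define MH where "MH = M <#>\<^bsub>G\<^esub> H"
    define E where "E = ND \<inter> MH"
    have sND: "subgroup ND G" and sMH: "subgroup MH G"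
      unfolding ND_def MH_def by (rule subgroup_set_mult[OF nN sD], rule subgroup_set_mult[OF nM sH])
    have sE: "subgroup E G" unfolding E_def by (rule subgroups_Inter_pair[OF sND sMH])
    have NMinv: "inv\<^bsub>G\<^esub> (n \<otimes>\<^bsub>G\<^esub> m) \<in> ?NM" if "n \<in> N" "m \<in> M" for n m
    proof (rule subgroup.m_inv_closed[OF normal_imp_subgroup[OF nNM]])
      show "n \<otimes>\<^bsub>G\<^esub> m \<in> ?NM" using that unfolding set_mult_def by blast
    qed
    have HE: "H \<subseteq> M <#>\<^bsub>G\<^esub> E"
    proof
      fix h assume h: "h \<in> H"
      then obtain n m k where nmk: "n \<in> N" "m \<in> M" "k \<in> K" "h = n \<otimes>\<^bsub>G\<^esub> m \<otimes>\<^bsub>G\<^esub> k"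
        using HK by (fastforce simp: set_mult_def)
      note c = closed(1)[OF nmk(1)] closed(2)[OF nmk(2)] closed(4)[OF nmk(3)]
      have "k = inv\<^bsub>G\<^esub> (n \<otimes>\<^bsub>G\<^esub> m) \<otimes>\<^bsub>G\<^esub> h"
        using c nmk(4) by (simp add: inv_solve_left)
      then have "k \<in> ?NM <#>\<^bsub>G\<^esub> H"
        using NMinv[OF nmk(1,2)] h unfolding set_mult_def by blast
      then have k: "k \<in> D" using nmk(3) by (simp add: D_def)
      let ?m = "n \<otimes>\<^bsub>G\<^esub> m \<otimes>\<^bsub>G\<^esub> inv\<^bsub>G\<^esub> n"
      have m': "?m \<in> M" by (rule normal.inv_op_closed2[OF nM c(1) nmk(2)])
      have h_eq: "h = ?m \<otimes>\<^bsub>G\<^esub> (n \<otimes>\<^bsub>G\<^esub> k)"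
      proof -
        have "inv\<^bsub>G\<^esub> n \<otimes>\<^bsub>G\<^esub> (n \<otimes>\<^bsub>G\<^esub> k) = k" using c by (simp flip: m_assoc)
        then show ?thesis using c nmk(4) by (simp add: m_assoc)
      qed
      have nk: "n \<otimes>\<^bsub>G\<^esub> k \<in> ND"
        using nmk(1) k by (auto simp: ND_def set_mult_def)
      have "n \<otimes>\<^bsub>G\<^esub> k = inv\<^bsub>G\<^esub> ?m \<otimes>\<^bsub>G\<^esub> h"
        using h_eq closed(2)[OF m'] c closed(3)[OF h] by (subst inv_solve_left) auto
      then have "n \<otimes>\<^bsub>G\<^esub> k \<in> MH"
        using subgroup.m_inv_closed[OF sM m'] h unfolding MH_def set_mult_def by blast
      then show "h \<in> M <#>\<^bsub>G\<^esub> E"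
        using h_eq m' nk unfolding E_def set_mult_def by blast
    qed
    have DE: "D \<subseteq> N <#>\<^bsub>G\<^esub> E"
    proof
      fix d assume d: "d \<in> D"
      then obtain n m h where nmh: "n \<in> N" "m \<in> M" "h \<in> H" "d = n \<otimes>\<^bsub>G\<^esub> m \<otimes>\<^bsub>G\<^esub> h"
        by (fastforce simp: D_def set_mult_def)
      note c = closed(1)[OF nmh(1)] closed(2)[OF nmh(2)] closed(3)[OF nmh(3)]
      have dn: "d = n \<otimes>\<^bsub>G\<^esub> (m \<otimes>\<^bsub>G\<^esub> h)" using c nmh(4) by (simp add: m_assoc)
      then have "m \<otimes>\<^bsub>G\<^esub> h = inv\<^bsub>G\<^esub> n \<otimes>\<^bsub>G\<^esub> d"
        using c by (simp flip: m_assoc)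
      then have "m \<otimes>\<^bsub>G\<^esub> h \<in> ND"
        using subgroup.m_inv_closed[OF sN nmh(1)] d unfolding ND_def set_mult_def by blast
      moreover have "m \<otimes>\<^bsub>G\<^esub> h \<in> MH"
        using nmh(2,3) unfolding MH_def set_mult_def by blast
      ultimately show "d \<in> N <#>\<^bsub>G\<^esub> E"
        using dn nmh(1) unfolding E_def set_mult_def by blast
    qed
    obtain L where L: "X_subgroup \<XX> G L" "E \<subseteq> (N \<inter> M) <#>\<^bsub>G\<^esub> L"
      using X_subgroup_lift_subdirect[OF fin nN nM sE XD _ XH] by (auto simp: E_def ND_def MH_def)
    then obtain L' where L': "L' \<in> X_maximals \<XX> G" "L \<subseteq> L'"
      using X_subgroup_extends[OF fin] by blast
    have sL': "subgroup L' G" using L'(1) by (simp add: X_maximals_def)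
    have E_L': "E \<subseteq> (N \<inter> M) <#>\<^bsub>G\<^esub> L'"
      using L(2) mono_set_mult[OF order_refl L'(2)] by blast
    have sNL': "subgroup (N <#>\<^bsub>G\<^esub> L') G" and sML': "subgroup (M <#>\<^bsub>G\<^esub> L') G"
      by (rule subgroup_set_mult[OF nN sL'], rule subgroup_set_mult[OF nM sL'])
    have H_ML': "H \<subseteq> M <#>\<^bsub>G\<^esub> L'"
    proof -
      have "E \<subseteq> M <#>\<^bsub>G\<^esub> L'"
        using E_L' mono_set_mult[of "N \<inter> M" M L' L' G] by blast
      then show ?thesis
        using HE set_mult_least[OF sML' subset_set_mult(2)[OF nM sL']] by blast
    qed
    have ND_NL': "ND \<subseteq> N <#>\<^bsub>G\<^esub> L'"
    proof -
      have "E \<subseteq> N <#>\<^bsub>G\<^esub> L'"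
        using E_L' mono_set_mult[of "N \<inter> M" N L' L' G] by blast
      then have "D \<subseteq> N <#>\<^bsub>G\<^esub> L'"
        using DE set_mult_least[OF sNL' subset_set_mult(2)[OF nN sL']] by blast
      then show ?thesis
        unfolding ND_def by (rule set_mult_least[OF sNL' subset_set_mult(2)[OF nN sL']])
    qed
    have HL': "conjugate_sets G H L'"
      using M H L'(1) H_ML' by (simp add: reducing_def)
    then obtain g where g: "g \<in> carrier G" "L' = conj_by g ` H"
      by (auto simp: conjugate_sets_iff)
    have HG: "H \<subseteq> carrier G" by (rule X_maximals_subset[OF H])
    have "M <#>\<^bsub>G\<^esub> L' = MH"
    proof -
      have "MH \<subseteq> M <#>\<^bsub>G\<^esub> L'"
        unfolding MH_def by (rule set_mult_least[OF sML' subset_set_mult(2)[OF nM sL'] H_ML'])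
      moreover have "M <#>\<^bsub>G\<^esub> L' = conj_by g ` MH"
        using conj_image_set_mult[OF nM HG g(1)] g(2) by (simp add: MH_def)
      then have "card (M <#>\<^bsub>G\<^esub> L') = card MH"
        using card_conj_image[OF g(1) subgroup.subset[OF sMH]] by simp
      moreover have "finite (M <#>\<^bsub>G\<^esub> L')"
        using finite_subset[OF subgroup.subset[OF sML'] fin] .
      ultimately show ?thesis by (metis card_subset_eq)
    qed
    then have L'_MH: "L' \<subseteq> MH"
      using subset_set_mult(1)[OF nM sL'] by simp

    define U where "U = ND \<inter> M"
    define V where "V = (N <#>\<^bsub>G\<^esub> L') \<inter> M"
    have sU: "subgroup U G" and sV: "subgroup V G"
      unfolding U_def V_def by (rule subgroups_Inter_pair[OF sND sM], rule subgroups_Inter_pair[OF sNL' sM])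
    have UV: "U \<subseteq> V" using ND_NL' by (auto simp: U_def V_def)
    have VM: "V \<subseteq> M" by (auto simp: V_def)
    have finV: "finite V" using finite_subset[OF subgroup.subset[OF sV] fin] .
    have V0: "card V \<noteq> 0"
      using finV subgroup.one_closed[OF sV] by (metis card_0_eq empty_iff)
    have MKU: "M \<inter> K \<subseteq> U"
    proof
      fix k assume k: "k \<in> M \<inter> K"
      then have "k \<in> M <#>\<^bsub>G\<^esub> H" using subset_set_mult(2)[OF nM sH] by blast
      have "k \<in> ?NM" using k subset_set_mult(1)[OF nN sM] by blast
      then have "k \<in> ?NM <#>\<^bsub>G\<^esub> H" using subset_set_mult(2)[OF nNM sH] by blast
      then have "k \<in> D" using k by (simp add: D_def)
      then show "k \<in> U"
        using k subset_set_mult(1)[OF nN sD] by (auto simp: U_def ND_def)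
    qed
    have "V = U"
    proof -
      let ?f = "\<lambda>x. N #>\<^bsub>G\<^esub> x"
      interpret f: group_hom G "G Mod N" ?f by (rule normal_projection(1)[OF nN])
      have ker: "kernel G (G Mod N) ?f = N" by (rule normal_projection(3)[OF nN])
      have "V \<inter> N = M \<inter> N"
        using subset_set_mult(2)[OF nN sL'] by (auto simp: V_def)
      then have cV: "card V = card (?f ` V) * card (M \<inter> N)"
        using f.card_image_mult_kernel[OF sV] ker by simp
      have "U \<inter> N = M \<inter> N"
        using subset_set_mult(2)[OF nN sD] by (auto simp: U_def ND_def)
      then have cU: "card U = card (?f ` U) * card (M \<inter> N)"
        using f.card_image_mult_kernel[OF sU] ker by simp
      obtain t where t: "card V = card U * t"
        using subgroup_card_dvd[OF sU sV UV] by (rule dvdE)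
      obtain a where a: "card M = card V * a"
        using subgroup_card_dvd[OF sV sM VM] by (rule dvdE)
      obtain c where c: "card U = card (M \<inter> K) * c"
        using subgroup_card_dvd[OF subgroups_Inter_pair[OF sM sK] sU MKU] by (rule dvdE)
      have M_eq: "card M = card (M \<inter> K) * (c * t * a)"
        using t a c by simp
      have "card (M \<inter> N) \<noteq> 0" using cV V0 by auto
      then have ft: "card (?f ` V) = card (?f ` U) * t"
        using t cV cU by simp
      have "X_subgroup \<XX> (G Mod N) (?f ` V)"
      proof (rule X_subgroup_mono[OF f.H.is_group _ f.subgroup_img_is_subgroup[OF sV]])
        show "X_subgroup \<XX> (G Mod N) (?f ` L')"
          using X_subgroup_image[OF f.group_hom_axioms] L'(1) by (simp add: X_maximals_iff)
        show "?f ` V \<subseteq> ?f ` L'"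
          using f.image_subset_iff_set_mult[OF subgroup.subset[OF sV] subgroup.subset[OF sL']] ker
          by (simp add: V_def)
      qed
      then have cl: "in_class \<XX> ((G Mod N)\<lparr>carrier := ?f ` V\<rparr>)"
        by (simp add: X_subgroup_def)
      \<comment> \<open>A prime dividing the index \<open>t\<close> divides the order of an \<open>\<XX>\<close>-group and the index of \<open>M \<inter> K\<close> in \<open>M\<close>.\<close>
      have "t = 1"
      proof (rule ccontr)
        assume "t \<noteq> 1"
        then obtain p where p: "Factorial_Ring.prime p" "p dvd t"
          using prime_factor_nat by blast
        have "class_prime p"
          by (rule class_primeI[OF p(1) cl]) (simp add: ft p(2))
        then have "\<not> p dvd c * t * a"
          by (rule reducing_hall[OF fin M K _ M_eq])
        then show False using p(2) by auto
      qed
      then show ?thesis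
        using card_subset_eq[OF finV UV] t by simp
    qed
    have "L' \<subseteq> ND"
    proof
      fix l assume l: "l \<in> L'"
      then obtain m h where mh: "m \<in> M" "h \<in> H" "l = m \<otimes>\<^bsub>G\<^esub> h"
        using L'_MH by (fastforce simp: MH_def set_mult_def)
      obtain m' e where me: "m' \<in> M" "e \<in> E" "h = m' \<otimes>\<^bsub>G\<^esub> e"
        using HE mh(2) by (fastforce simp: set_mult_def)
      have eND: "e \<in> ND" using me(2) by (simp add: E_def)
      have eG: "e \<in> carrier G" by (rule subgroup.mem_carrier[OF sND eND])
      note c = closed(2)[OF mh(1)] closed(2)[OF me(1)] eG
      let ?m = "m \<otimes>\<^bsub>G\<^esub> m'"
      have mM: "?m \<in> M" by (rule subgroup.m_closed[OF sM mh(1) me(1)])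
      have l_eq: "l = ?m \<otimes>\<^bsub>G\<^esub> e" using mh(3) me(3) c by (simp add: m_assoc)
      then have "?m = l \<otimes>\<^bsub>G\<^esub> inv\<^bsub>G\<^esub> e" using c by (simp add: m_assoc)
      moreover have "l \<in> N <#>\<^bsub>G\<^esub> L'" using l subset_set_mult(1)[OF nN sL'] by blast
      moreover have "inv\<^bsub>G\<^esub> e \<in> N <#>\<^bsub>G\<^esub> L'"
        using subgroup.m_inv_closed[OF sNL'] ND_NL' eND by blast
      ultimately have "?m \<in> N <#>\<^bsub>G\<^esub> L'"
        using subgroup.m_closed[OF sNL'] by simp
      then have "?m \<in> ND" using mM \<open>V = U\<close> unfolding U_def V_def by blast
      then show "l \<in> ND" using l_eq eND subgroup.m_closed[OF sND] by simp
    qed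
    moreover have "ND \<subseteq> N <#>\<^bsub>G\<^esub> K"
      unfolding ND_def by (rule mono_set_mult) (auto simp: D_def)
    ultimately have "conjugate_sets G L' K"
      using N L'(1) K by (auto simp: reducing_def)
    then show ?thesis
      using conjugate_sets_trans[OF HG HL'] by blast
  qed
  then show ?thesis using nNM by (simp add: reducing_def)
qed

end

section \<open>Schemes, isoschematisms and the number of conjugacy classes\<close>

lemma (in group_hom) image_conj:
  assumes "g \<in> carrier G" "A \<subseteq> carrier G"
  shows "h ` G.conj_by g ` A = H.conj_by (h g) ` h ` A"
  using assms unfolding image_image
  by (intro image_cong) (auto simp: G.conj_by_def H.conj_by_def subset_iff)

lemma (in group_hom) conjugate_sets_image:
  assumes "A \<subseteq> carrier G" "conjugate_sets G A B"
  shows "conjugate_sets H (h ` A) (h ` B)"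
proof -
  obtain g where g: "g \<in> carrier G" "B = G.conj_by g ` A"
    using assms(2) by (auto simp: G.conjugate_sets_iff)
  then have "h ` B = H.conj_by (h g) ` h ` A" "h g \<in> carrier H"
    using image_conj[OF _ assms(1)] by simp_all
  then show ?thesis
    unfolding H.conjugate_sets_iff by blast
qed

lemma equiv_conjugate_maximals:
  assumes "group G"
  shows "equiv (X_maximals \<XX> G)
    {(H, K). H \<in> X_maximals \<XX> G \<and> K \<in> X_maximals \<XX> G \<and> conjugate_sets G H K}"
proof -
  interpret group G by fact
  show ?thesis
    using conjugate_sets_refl[OF X_maximals_subset] conjugate_sets_sym[OF X_maximals_subset]
      conjugate_sets_trans[OF X_maximals_subset]
    by (intro equivI refl_onI symI transI) (blast+)
qed

lemma X_scheme_iff: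
  assumes G: "group G"
  shows "X_scheme \<XX> G S \<longleftrightarrow> S \<subseteq> X_maximals \<XX> G \<and>
    (\<forall>M\<in>X_maximals \<XX> G. \<exists>H\<in>S. conjugate_sets G M H) \<and>
    (\<forall>H\<in>S. \<forall>K\<in>S. conjugate_sets G H K \<longrightarrow> H = K)" (is "_ \<longleftrightarrow> ?rhs")
proof -
  interpret group G by fact
  note sub = X_maximals_subset
  have "X_scheme \<XX> G S \<longleftrightarrow> S \<subseteq> X_maximals \<XX> G \<and>
    (\<forall>M\<in>X_maximals \<XX> G. \<exists>!H. H \<in> S \<and> H \<in> X_maximals \<XX> G \<and> conjugate_sets G M H)"
    by (simp add: X_scheme_def X_conj_classes_def quotient_def)
  also have "\<dots> \<longleftrightarrow> ?rhs"
  proof (intro conj_cong refl iffI conjI ballI impI)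
    assume S: "S \<subseteq> X_maximals \<XX> G"
      and ex1: "\<forall>M\<in>X_maximals \<XX> G. \<exists>!H. H \<in> S \<and> H \<in> X_maximals \<XX> G \<and> conjugate_sets G M H"
    show "\<exists>H\<in>S. conjugate_sets G M H" if "M \<in> X_maximals \<XX> G" for M
      using ex1 that by blast
    show "H = K" if "H \<in> S" "K \<in> S" "conjugate_sets G H K" for H K
      using ex1 that S conjugate_sets_refl[OF sub[of H]] by blast
  next
    fix M assume S: "S \<subseteq> X_maximals \<XX> G" and M: "M \<in> X_maximals \<XX> G"
      and *: "(\<forall>M\<in>X_maximals \<XX> G. \<exists>H\<in>S. conjugate_sets G M H) \<and>
        (\<forall>H\<in>S. \<forall>K\<in>S. conjugate_sets G H K \<longrightarrow> H = K)"
    then obtain H where H: "H \<in> S" "conjugate_sets G M H" by blast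
    show "\<exists>!H. H \<in> S \<and> H \<in> X_maximals \<XX> G \<and> conjugate_sets G M H"
    proof (rule ex1I[of _ H])
      fix K assume K: "K \<in> S \<and> K \<in> X_maximals \<XX> G \<and> conjugate_sets G M K"
      then have "conjugate_sets G K M" using conjugate_sets_sym[OF sub[OF M]] by blast
      then have "conjugate_sets G K H" using conjugate_sets_trans[OF sub] K H(2) by blast
      then show "K = H" using * K H(1) by blast
    qed (use H S in blast)
  qed
  finally show ?thesis .
qed

lemma X_scheme_exists:
  assumes G: "group G"
  shows "\<exists>S. X_scheme \<XX> G S"
proof -
  interpret group G by fact
  note sub = X_maximals_subset
  let ?P = "\<lambda>M H. H \<in> X_maximals \<XX> G \<and> conjugate_sets G M H"
  define rep where "rep M = (SOME H. ?P M H)" for M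
  have rep: "?P M (rep M)" if M: "M \<in> X_maximals \<XX> G" for M
    unfolding rep_def by (rule someI[of "?P M" M]) (simp add: M conjugate_sets_refl[OF sub[OF M]])
  have rep_eq: "rep M = rep M'" if "M \<in> X_maximals \<XX> G" "M' \<in> X_maximals \<XX> G" "conjugate_sets G M M'" for M M'
  proof -
    have "?P M = ?P M'"
      using that conjugate_sets_trans[OF sub] conjugate_sets_sym[OF sub] by blast
    then show ?thesis by (simp add: rep_def)
  qed
  have "X_scheme \<XX> G (rep ` X_maximals \<XX> G)"
    unfolding X_scheme_iff[OF G]
  proof (intro conjI ballI impI)
    show "rep ` X_maximals \<XX> G \<subseteq> X_maximals \<XX> G" using rep by blast
    show "\<exists>H\<in>rep ` X_maximals \<XX> G. conjugate_sets G M H" if "M \<in> X_maximals \<XX> G" for M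
      using rep that by blast
    fix H K assume "H \<in> rep ` X_maximals \<XX> G" "K \<in> rep ` X_maximals \<XX> G" and c: "conjugate_sets G H K"
    then obtain M M' where M: "M \<in> X_maximals \<XX> G" "M' \<in> X_maximals \<XX> G" "H = rep M" "K = rep M'" by blast
    have "conjugate_sets G M K" using rep M c conjugate_sets_trans[OF sub] by blast
    moreover have "conjugate_sets G K M'" using rep M conjugate_sets_sym[OF sub] by blast
    ultimately have "conjugate_sets G M M'" using M conjugate_sets_trans[OF sub] by blast
    then show "H = K" using rep_eq M by simp
  qed
  then show ?thesis by blast
qed

lemma k_X_eq_card_scheme:
  assumes G: "group G" and S: "X_scheme \<XX> G S"
  shows "k_X \<XX> G = card S"
proof -
  interpret group G by fact
  let ?r = "{(H, K). H \<in> X_maximals \<XX> G \<and> K \<in> X_maximals \<XX> G \<and> conjugate_sets G H K}"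
  note r = equiv_conjugate_maximals[OF G, of \<XX>]
  have S': "S \<subseteq> X_maximals \<XX> G" "\<And>M. M \<in> X_maximals \<XX> G \<Longrightarrow> \<exists>H\<in>S. conjugate_sets G M H"
    "\<And>H K. H \<in> S \<Longrightarrow> K \<in> S \<Longrightarrow> conjugate_sets G H K \<Longrightarrow> H = K"
    using S by (auto simp: X_scheme_iff[OF G])
  have "bij_betw (\<lambda>H. ?r `` {H}) S (X_maximals \<XX> G // ?r)"
  proof (rule bij_betw_imageI)
    show "inj_on (\<lambda>H. ?r `` {H}) S"
    proof (rule inj_onI)
      fix H K assume HK: "H \<in> S" "K \<in> S" "?r `` {H} = ?r `` {K}"
      then have "(H, K) \<in> ?r" using eq_equiv_class[OF _ r] S'(1) by blast
      then show "H = K" using S'(3) HK by blast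
    qed
    show "(\<lambda>H. ?r `` {H}) ` S = X_maximals \<XX> G // ?r"
    proof
      show "(\<lambda>H. ?r `` {H}) ` S \<subseteq> X_maximals \<XX> G // ?r"
        using S'(1) quotientI[of _ _ ?r] by blast
      show "X_maximals \<XX> G // ?r \<subseteq> (\<lambda>H. ?r `` {H}) ` S"
      proof
        fix C assume "C \<in> X_maximals \<XX> G // ?r"
        then obtain M where M: "M \<in> X_maximals \<XX> G" "C = ?r `` {M}" by (rule quotientE)
        then obtain H where H: "H \<in> S" "conjugate_sets G M H" using S'(2) by blast
        then have "(M, H) \<in> ?r" using M(1) S'(1) by blast
        then have "C = ?r `` {H}" using equiv_class_eq[OF r] M(2) by simp
        then show "C \<in> (\<lambda>H. ?r `` {H}) ` S" using H(1) by blast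
      qed
    qed
  qed
  from bij_betw_same_card[OF this] show ?thesis
    unfolding k_X_def X_conj_classes_def by (rule sym)
qed

lemma reducing_kernel_iff:
  assumes "group_hom G H f"
  shows "reducing \<XX> G (kernel G H f) \<longleftrightarrow>
    (\<forall>A\<in>X_maximals \<XX> G. \<forall>B\<in>X_maximals \<XX> G. f ` A \<subseteq> f ` B \<longrightarrow> conjugate_sets G A B)"
  using group_hom.image_subset_iff_set_mult[OF assms X_maximals_subset X_maximals_subset]
    group_hom.normal_kernel[OF assms]
  by (simp add: reducing_def)

context complete_group_class
begin

text \<open>
  In general the image of a maximal subgroup is not maximal, but every maximal subgroup of the image
  arises in this way. Consequently epimorphisms do not increase \<open>k_X\<close>.
\<close>
lemma X_maximal_lift:
  assumes fin: "finite (carrier G)" and f: "group_hom G H f" and surj: "f ` carrier G = carrier H"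
    and K: "K \<in> X_maximals \<XX> H"
  shows "\<exists>M\<in>X_maximals \<XX> G. f ` M = K"
proof -
  have "X_subgroup \<XX> H K" using K by (simp add: X_maximals_iff)
  then obtain L where L: "X_subgroup \<XX> G L" "f ` L = K"
    using X_subgroup_lift[OF fin f surj] by blast
  obtain M where M: "M \<in> X_maximals \<XX> G" "L \<subseteq> M"
    using X_subgroup_extends[OF fin L(1)] by blast
  have "X_subgroup \<XX> H (f ` M)"
    using X_subgroup_image[OF f] M(1) by (simp add: X_maximals_iff)
  moreover have "K \<subseteq> f ` M" using L(2) M(2) by blast
  ultimately have "f ` M = K" using K by (simp add: X_maximals_iff)
  then show ?thesis using M(1) by blast
qed

text \<open>
  If the image of \<open>A\<close> is contained in the maximal subgroup \<open>f ` B\<close>, then \<open>A\<close> is conjugate to \<open>B\<close>,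
  and hence the image of \<open>A\<close> is conjugate to \<open>f ` B\<close>.
\<close>
lemma reducing_image_maximal:
  assumes fin: "finite (carrier G)" and f: "group_hom G H f" and surj: "f ` carrier G = carrier H"
    and red: "reducing \<XX> G (kernel G H f)" and A: "A \<in> X_maximals \<XX> G"
  shows "f ` A \<in> X_maximals \<XX> H"
proof -
  interpret f: group_hom G H f by fact
  have "finite (carrier H)" using fin surj by (metis finite_imageI)
  moreover have XA: "X_subgroup \<XX> H (f ` A)"
    using X_subgroup_image[OF f] A by (simp add: X_maximals_iff)
  ultimately obtain K where K: "K \<in> X_maximals \<XX> H" "f ` A \<subseteq> K"
    using X_subgroup_extends by blast
  obtain B where B: "B \<in> X_maximals \<XX> G" "f ` B = K"
    using X_maximal_lift[OF fin f surj K(1)] by blast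
  then have "conjugate_sets G A B"
    using red K(2) A by (simp add: reducing_kernel_iff[OF f])
  then have "conjugate_sets H (f ` A) (f ` B)"
    by (rule f.conjugate_sets_image[OF X_maximals_subset[OF A]])
  then have c: "conjugate_sets H (f ` B) (f ` A)"
    using f.H.conjugate_sets_sym XA subgroup.subset unfolding X_subgroup_def by blast
  then obtain g where "g \<in> carrier H" "f ` A = f.H.conj_by g ` K"
    using B(2) by (auto simp: f.H.conjugate_sets_iff)
  then show ?thesis
    using X_maximals_conj[OF f.H.is_group K(1)] by simp
qed

lemma reducing_conjugate_image:
  assumes f: "group_hom G H f" and surj: "f ` carrier G = carrier H"
    and red: "reducing \<XX> G (kernel G H f)" and A: "A \<in> X_maximals \<XX> G" and B: "B \<in> X_maximals \<XX> G"
    and c: "conjugate_sets H (f ` A) (f ` B)"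
  shows "conjugate_sets G A B"
proof -
  interpret f: group_hom G H f by fact
  have AG: "A \<subseteq> carrier G" by (rule X_maximals_subset[OF A])
  obtain h where h: "h \<in> carrier H" "f ` B = f.H.conj_by h ` f ` A"
    using c by (auto simp: f.H.conjugate_sets_iff)
  then obtain g where g: "g \<in> carrier G" "h = f g" using surj by blast
  have "f ` f.G.conj_by g ` A \<subseteq> f ` B"
    using f.image_conj[OF g(1) AG] h(2) g(2) by simp
  then have "conjugate_sets G (f.G.conj_by g ` A) B"
    using red X_maximals_conj[OF f.G.is_group A g(1)] B by (simp add: reducing_kernel_iff[OF f])
  moreover have "conjugate_sets G A (f.G.conj_by g ` A)"
    using g(1) by (auto simp: f.G.conjugate_sets_iff)
  ultimately show ?thesis
    using f.G.conjugate_sets_trans[OF AG] by blast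
qed

lemma isoschematism_iff_reducing:
  "isoschematism \<XX> G H f \<longleftrightarrow>
     finite_group G \<and> finite_group H \<and> f \<in> epi G H \<and> reducing \<XX> G (kernel G H f)"
proof (cases "finite_group G \<and> finite_group H \<and> f \<in> epi G H")
  case True
  then have gG: "group G" and gH: "group H" and fin: "finite (carrier G)"
    by (auto simp: finite_group_def)
  have f: "group_hom G H f" and surj: "f ` carrier G = carrier H"
    using True epi_iff_group_hom[OF gG gH] by auto
  interpret f: group_hom G H f by fact
  note sub = X_maximals_subset
  have "reducing \<XX> G (kernel G H f)" if iso: "isoschematism \<XX> G H f"
    unfolding reducing_kernel_iff[OF f]
  proof (intro ballI impI)
    obtain S where S: "X_scheme \<XX> G S" and inj: "inj_on (\<lambda>H. f ` H) S"
      and T: "X_scheme \<XX> H ((\<lambda>H. f ` H) ` S)"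
      using iso by (auto simp: isoschematism_def)
    fix A B assume A: "A \<in> X_maximals \<XX> G" and B: "B \<in> X_maximals \<XX> G" and AB: "f ` A \<subseteq> f ` B"
    obtain A' B' where A': "A' \<in> S" "conjugate_sets G A A'" and B': "B' \<in> S" "conjugate_sets G B B'"
      using S A B unfolding X_scheme_iff[OF gG] by blast
    have SG: "A' \<in> X_maximals \<XX> G" "B' \<in> X_maximals \<XX> G"
      using S A'(1) B'(1) by (auto simp: X_scheme_iff[OF gG])
    have SH: "f ` A' \<in> X_maximals \<XX> H" "f ` B' \<in> X_maximals \<XX> H"
      using T A'(1) B'(1) by (auto simp: X_scheme_iff[OF gH])
    have A'A: "conjugate_sets H (f ` A') (f ` A)"
      using f.conjugate_sets_image[OF sub f.G.conjugate_sets_sym[OF sub]] A A'(2) SG by blast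
    then have "f ` A \<in> X_maximals \<XX> H"
      using X_maximals_conj[OF gH SH(1)] by (auto simp: f.H.conjugate_sets_iff)
    moreover have "X_subgroup \<XX> H (f ` B)"
      using X_subgroup_image[OF f] B by (simp add: X_maximals_iff)
    ultimately have "f ` B = f ` A"
      using AB by (simp add: X_maximals_iff)
    then have "conjugate_sets H (f ` A) (f ` B')"
      using f.conjugate_sets_image[OF sub[OF B] B'(2)] by simp
    then have "conjugate_sets H (f ` A') (f ` B')"
      using f.H.conjugate_sets_trans[OF sub[OF SH(1)] A'A] by blast
    then have "f ` A' = f ` B'"
      using T A'(1) B'(1) unfolding X_scheme_iff[OF gH] by blast
    then have "A' = B'"
      using inj_onD[OF inj] A'(1) B'(1) by simp
    then show "conjugate_sets G A B"
      using f.G.conjugate_sets_trans[OF sub[OF A] A'(2)] f.G.conjugate_sets_sym[OF sub[OF B] B'(2)] by simp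
  qed
  moreover have "isoschematism \<XX> G H f" if red: "reducing \<XX> G (kernel G H f)"
  proof -
    obtain S where S: "X_scheme \<XX> G S" using X_scheme_exists[OF gG] by blast
    then have S': "S \<subseteq> X_maximals \<XX> G" "\<And>M. M \<in> X_maximals \<XX> G \<Longrightarrow> \<exists>H\<in>S. conjugate_sets G M H"
      "\<And>H K. H \<in> S \<Longrightarrow> K \<in> S \<Longrightarrow> conjugate_sets G H K \<Longrightarrow> H = K"
      by (auto simp: X_scheme_iff[OF gG])
    note conj_eq = reducing_conjugate_image[OF f surj red]
    have im: "f ` A \<in> X_maximals \<XX> H" if "A \<in> S" for A
      using reducing_image_maximal[OF fin f surj red] S'(1) that by blast
    have "inj_on (\<lambda>H. f ` H) S"
    proof (rule inj_onI)
      fix A B assume AB: "A \<in> S" "B \<in> S" "f ` A = f ` B"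
      then have "conjugate_sets H (f ` A) (f ` B)"
        using f.H.conjugate_sets_refl[OF sub[OF im]] by metis
      then show "A = B" using conj_eq[of A B] S' AB by blast
    qed
    moreover have "X_scheme \<XX> H ((\<lambda>H. f ` H) ` S)"
      unfolding X_scheme_iff[OF gH]
    proof (intro conjI ballI impI)
      show "(\<lambda>H. f ` H) ` S \<subseteq> X_maximals \<XX> H" using im by blast
      fix K assume "K \<in> X_maximals \<XX> H"
      then obtain M where M: "M \<in> X_maximals \<XX> G" "f ` M = K"
        using X_maximal_lift[OF fin f surj] by blast
      then obtain A where A: "A \<in> S" "conjugate_sets G M A" using S'(2) by blast
      then have "conjugate_sets H K (f ` A)"
        using f.conjugate_sets_image[OF sub[OF M(1)] A(2)] M(2) by simp
      then show "\<exists>L\<in>(\<lambda>H. f ` H) ` S. conjugate_sets H K L" using A(1) by blast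
    next
      fix K L assume "K \<in> (\<lambda>H. f ` H) ` S" "L \<in> (\<lambda>H. f ` H) ` S" and c: "conjugate_sets H K L"
      then obtain A B where AB: "A \<in> S" "B \<in> S" "K = f ` A" "L = f ` B" by blast
      then have "A = B" using conj_eq[of A B] S' c by blast
      then show "K = L" using AB by simp
    qed
    ultimately show ?thesis
      using S True unfolding isoschematism_def by blast
  qed
  ultimately show ?thesis using True by blast
next
  case False
  then show ?thesis by (auto simp: isoschematism_def)
qed

text \<open>
  Preimages \<open>l K\<close> of the members of a scheme of \<open>H\<close> are pairwise not conjugate. When the numbers of
  classes agree, they represent all classes, so that they form a scheme with the required image.
\<close>
lemma k_X_eq_iff_isoschematism:
  assumes G: "finite_group G" and H: "finite_group H" and f: "f \<in> epi G H"
  shows "k_X \<XX> G = k_X \<XX> H \<longleftrightarrow> isoschematism \<XX> G H f"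
proof
  have gG: "group G" and gH: "group H" and fin: "finite (carrier G)"
    using G H by (auto simp: finite_group_def)
  have hom: "group_hom G H f" and surj: "f ` carrier G = carrier H"
    using f epi_iff_group_hom[OF gG gH] by auto
  interpret f: group_hom G H f by fact
  note sub = X_maximals_subset
  {
    assume "isoschematism \<XX> G H f"
    then obtain S where "X_scheme \<XX> G S" "inj_on (\<lambda>H. f ` H) S" "X_scheme \<XX> H ((\<lambda>H. f ` H) ` S)"
      by (auto simp: isoschematism_def)
    then show "k_X \<XX> G = k_X \<XX> H"
      using k_X_eq_card_scheme[OF gG] k_X_eq_card_scheme[OF gH] card_image by metis
  }
  assume k: "k_X \<XX> G = k_X \<XX> H"
  obtain S where S: "X_scheme \<XX> G S" using X_scheme_exists[OF gG] by blast
  obtain T where T: "X_scheme \<XX> H T" using X_scheme_exists[OF gH] by blast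
  have S': "S \<subseteq> X_maximals \<XX> G" "\<And>M. M \<in> X_maximals \<XX> G \<Longrightarrow> \<exists>H\<in>S. conjugate_sets G M H"
    using S by (auto simp: X_scheme_iff[OF gG])
  have T': "T \<subseteq> X_maximals \<XX> H" "\<And>K L. K \<in> T \<Longrightarrow> L \<in> T \<Longrightarrow> conjugate_sets H K L \<Longrightarrow> K = L"
    using T by (auto simp: X_scheme_iff[OF gH])
  have "\<forall>K\<in>T. \<exists>M. M \<in> X_maximals \<XX> G \<and> f ` M = K"
    using X_maximal_lift[OF fin hom surj] T'(1) by blast
  then obtain l where l: "\<And>K. K \<in> T \<Longrightarrow> l K \<in> X_maximals \<XX> G" "\<And>K. K \<in> T \<Longrightarrow> f ` l K = K"
    by metis
  have "\<forall>K\<in>T. \<exists>A. A \<in> S \<and> conjugate_sets G (l K) A"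
    using S'(2) l(1) by blast
  then obtain s where s: "\<And>K. K \<in> T \<Longrightarrow> s K \<in> S" "\<And>K. K \<in> T \<Longrightarrow> conjugate_sets G (l K) (s K)"
    by metis
  have l_conj: "K = L" if "K \<in> T" "L \<in> T" "conjugate_sets G (l K) (l L)" for K L
    using f.conjugate_sets_image[OF sub[OF l(1)[OF that(1)]] that(3)] l(2) that T'(2) by simp
  have inj: "inj_on s T"
  proof (rule inj_onI)
    fix K L assume KL: "K \<in> T" "L \<in> T" "s K = s L"
    then have "conjugate_sets G (s K) (l L)"
      using f.G.conjugate_sets_sym[OF sub[OF l(1)] s(2)] by metis
    then have "conjugate_sets G (l K) (l L)"
      using f.G.conjugate_sets_trans[OF sub[OF l(1)] s(2)] KL(1) by blast
    then show "K = L" using l_conj KL by blast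
  qed
  have "S \<subseteq> Pow (carrier G)" using S'(1) sub by blast
  then have "finite S" using fin by (meson finite_Pow_iff finite_subset)
  moreover have "s ` T \<subseteq> S" using s(1) by blast
  moreover have "card (s ` T) = card S"
    using card_image[OF inj] k k_X_eq_card_scheme[OF gG S] k_X_eq_card_scheme[OF gH T] by simp
  ultimately have sT: "s ` T = S" by (rule card_subset_eq)
  have "X_scheme \<XX> G (l ` T)"
    unfolding X_scheme_iff[OF gG]
  proof (intro conjI ballI impI)
    show "l ` T \<subseteq> X_maximals \<XX> G" using l(1) by blast
    fix M assume M: "M \<in> X_maximals \<XX> G"
    then obtain A where A: "A \<in> S" "conjugate_sets G M A" using S'(2) by blast
    then obtain K where K: "K \<in> T" "A = s K" using sT by blast
    have "conjugate_sets G A (l K)"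
      using f.G.conjugate_sets_sym[OF sub[OF l(1)] s(2)] K by simp
    then have "conjugate_sets G M (l K)"
      using f.G.conjugate_sets_trans[OF sub[OF M] A(2)] by blast
    then show "\<exists>L\<in>l ` T. conjugate_sets G M L" using K(1) by blast
  qed (use l_conj in blast)
  moreover have "inj_on (\<lambda>H. f ` H) (l ` T)"
    by (rule inj_on_imageI) (auto intro!: inj_onI simp: l(2))
  moreover have "(\<lambda>H. f ` H) ` l ` T = (\<lambda>K. K) ` T"
    unfolding image_image by (rule image_cong) (simp_all add: l(2))
  then have "(\<lambda>H. f ` H) ` l ` T = T" by simp
  ultimately show "isoschematism \<XX> G H f"
    using G H f T unfolding isoschematism_def by metis
qed

end

section \<open>Complete reductions\<close>

context complete_group_class
begin

lemma isoschematismD: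
  assumes "isoschematism \<XX> G H f"
  shows "finite_group G" "finite_group H" "group G" "group H" "f \<in> epi G H"
    "group_hom G H f" "f ` carrier G = carrier H" "reducing \<XX> G (kernel G H f)"
  using assms epi_iff_group_hom[of G H f]
  by (auto simp: isoschematism_iff_reducing finite_group_def)

lemma isoschematism_comp:
  assumes f: "isoschematism \<XX> G H f" and g: "isoschematism \<XX> H K g"
  shows "isoschematism \<XX> G K (g \<circ> f)"
proof -
  note f' = isoschematismD[OF f] and g' = isoschematismD[OF g]
  have fin: "finite (carrier G)" using f'(1) by (simp add: finite_group_def)
  have epi: "g \<circ> f \<in> epi G K" using epi_compose[OF f'(5) g'(5)] .
  then have hom: "group_hom G K (g \<circ> f)"
    using epi_iff_group_hom[OF f'(3) g'(4)] by blast
  have "reducing \<XX> G (kernel G K (g \<circ> f))"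
    unfolding reducing_kernel_iff[OF hom]
  proof (intro ballI impI)
    fix A B assume A: "A \<in> X_maximals \<XX> G" and B: "B \<in> X_maximals \<XX> G"
      and AB: "(g \<circ> f) ` A \<subseteq> (g \<circ> f) ` B"
    have "f ` A \<in> X_maximals \<XX> H" "f ` B \<in> X_maximals \<XX> H"
      using reducing_image_maximal[OF fin f'(6-8)] A B by blast+
    moreover have "g ` f ` A \<subseteq> g ` f ` B"
      using AB by (simp add: image_comp)
    ultimately have "conjugate_sets H (f ` A) (f ` B)"
      using g'(8) unfolding reducing_kernel_iff[OF g'(6)] by blast
    then show "conjugate_sets G A B"
      by (rule reducing_conjugate_image[OF f'(6-8) A B])
  qed
  then show ?thesis
    using f'(1) g'(2) epi by (simp add: isoschematism_iff_reducing)
qed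

lemma isoschematism_comp_rev:
  assumes f: "f \<in> epi G H" and H: "finite_group H" and g: "g \<in> epi H K"
    and gf: "isoschematism \<XX> G K (g \<circ> f)"
  shows "isoschematism \<XX> H K g"
proof -
  note gf' = isoschematismD[OF gf]
  have gH: "group H" using H by (simp add: finite_group_def)
  have fin: "finite (carrier G)" using gf'(1) by (simp add: finite_group_def)
  have hf: "group_hom G H f" "f ` carrier G = carrier H" and hg: "group_hom H K g"
    using f g epi_iff_group_hom[OF gf'(3) gH] epi_iff_group_hom[OF gH gf'(4)] by auto
  interpret f: group_hom G H f by (rule hf(1))
  have "reducing \<XX> H (kernel H K g)"
    unfolding reducing_kernel_iff[OF hg]
  proof (intro ballI impI)
    fix A B assume A: "A \<in> X_maximals \<XX> H" and B: "B \<in> X_maximals \<XX> H" and AB: "g ` A \<subseteq> g ` B"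
    obtain A' where A': "A' \<in> X_maximals \<XX> G" "f ` A' = A"
      using X_maximal_lift[OF fin hf A] by blast
    obtain B' where B': "B' \<in> X_maximals \<XX> G" "f ` B' = B"
      using X_maximal_lift[OF fin hf B] by blast
    have "(g \<circ> f) ` A' \<subseteq> (g \<circ> f) ` B'"
      unfolding image_comp[symmetric] using AB A'(2) B'(2) by simp
    then have "conjugate_sets G A' B'"
      using gf'(8) A'(1) B'(1) unfolding reducing_kernel_iff[OF gf'(6)] by blast
    then show "conjugate_sets H A B"
      using f.conjugate_sets_image[OF X_maximals_subset[OF A'(1)]] A'(2) B'(2) by blast
  qed
  then show ?thesis
    using H gf'(2) g by (simp add: isoschematism_iff_reducing)
qed

lemma projection_epi:
  assumes G: "finite_group G" and N: "N \<lhd> G"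
  shows "finite_group (G Mod N)" "(\<lambda>x. N #>\<^bsub>G\<^esub> x) \<in> epi G (G Mod N)"
proof -
  show "finite_group (G Mod N)"
    using G normal.factorgroup_is_group[OF N] by (simp add: finite_group_def carrier_FactGroup)
  then show "(\<lambda>x. N #>\<^bsub>G\<^esub> x) \<in> epi G (G Mod N)"
    using normal_projection(1,2)[OF N] epi_iff_group_hom[of G "G Mod N"] G by (simp add: finite_group_def)
qed

lemma k_X_quotient_iff_reducing:
  assumes G: "finite_group G" and N: "N \<lhd> G"
  shows "k_X \<XX> G = k_X \<XX> (G Mod N) \<longleftrightarrow> reducing \<XX> G N"
  using k_X_eq_iff_isoschematism[OF G projection_epi[OF G N]] projection_epi[OF G N] G
    normal_projection(3)[OF N]
  by (simp add: isoschematism_iff_reducing)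

lemma reducing_trivial:
  assumes "group G"
  shows "reducing \<XX> G {\<one>\<^bsub>G\<^esub>}"
proof -
  interpret group G by fact
  have "conjugate_sets G A B"
    if A: "A \<in> X_maximals \<XX> G" and B: "B \<in> X_maximals \<XX> G" and AB: "A \<subseteq> {\<one>\<^bsub>G\<^esub>} <#>\<^bsub>G\<^esub> B" for A B
  proof -
    have "A \<subseteq> B"
      using AB X_maximals_subset[OF B] by (force simp: set_mult_def)
    then have "B = A"
      using A B by (auto simp: X_maximals_iff)
    then show ?thesis using conjugate_sets_refl[OF X_maximals_subset[OF A]] by simp
  qed
  then show ?thesis using one_is_normal by (simp add: reducing_def)
qed

text \<open>
  A maximal reducing subgroup absorbs every other one because products of reducing subgroups are
  reducing.
\<close>
lemma reduction_kernel_greatest: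
  assumes G: "finite_group G"
  shows "reducing \<XX> G (reduction_kernel \<XX> G)"
    and "reducing \<XX> G N \<Longrightarrow> N \<subseteq> reduction_kernel \<XX> G"
proof -
  have gG: "group G" and fin: "finite (carrier G)" using G by (auto simp: finite_group_def)
  interpret group G by (rule gG)
  let ?R = "{N. reducing \<XX> G N}"
  have sub: "subgroup N G" if "reducing \<XX> G N" for N
    using that normal_imp_subgroup by (auto simp: reducing_def)
  have "?R \<subseteq> Pow (carrier G)" using sub subgroup.subset by blast
  then have "finite ?R" using fin by (meson finite_Pow_iff finite_subset)
  moreover have "{\<one>\<^bsub>G\<^esub>} \<in> ?R" using reducing_trivial[OF gG] by simp
  ultimately obtain R where R: "reducing \<XX> G R" and max: "\<And>N. reducing \<XX> G N \<Longrightarrow> R \<subseteq> N \<Longrightarrow> R = N"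
    using finite_has_maximal2[of ?R "{\<one>\<^bsub>G\<^esub>}"] by blast
  have nR: "R \<lhd> G" using R by (simp add: reducing_def)
  have le: "N \<subseteq> R" if N: "reducing \<XX> G N" for N
  proof -
    have nN: "N \<lhd> G" using N by (simp add: reducing_def)
    have "R = N <#>\<^bsub>G\<^esub> R"
      by (rule max[OF reducing_set_mult[OF fin N R] subset_set_mult(1)[OF nN sub[OF R]]])
    then show ?thesis using subset_set_mult(2)[OF nN sub[OF R]] by simp
  qed
  have "{N. N \<lhd> G \<and> k_X \<XX> G = k_X \<XX> (G Mod N)} = ?R"
    using k_X_quotient_iff_reducing[OF G] by (auto simp: reducing_def)
  then have "reduction_kernel \<XX> G = generate G (\<Union>?R)"
    by (simp add: reduction_kernel_def)
  moreover have "\<Union>?R = R" using le R by blast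
  moreover have "generate G R = R"
    using generate_subgroup_incl[OF order_refl sub[OF R]] generate.incl[of _ R G] by blast
  ultimately have eq: "reduction_kernel \<XX> G = R" by simp
  show "reducing \<XX> G (reduction_kernel \<XX> G)" using R eq by simp
  show "reducing \<XX> G N \<Longrightarrow> N \<subseteq> reduction_kernel \<XX> G" using le eq by simp
qed

lemma projection_isoschematism:
  assumes G: "finite_group G" and N: "reducing \<XX> G N"
  shows "isoschematism \<XX> G (G Mod N) (\<lambda>x. N #>\<^bsub>G\<^esub> x)"
proof -
  have nN: "N \<lhd> G" using N by (simp add: reducing_def)
  show ?thesis
    using projection_epi[OF G nN] G N normal_projection(3)[OF nN]
    by (simp add: isoschematism_iff_reducing)
qed

text \<open>
  The kernel of an isoschematism is always contained in the reduction kernel \<open>R\<close> of \<open>G\<close>. If it is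
  smaller, then \<open>G \<rightarrow> G / R\<close> factors through an isoschematism of \<open>C\<close> with nontrivial kernel; and a
  nontrivial reducing subgroup of \<open>C\<close> would give a reducing subgroup of \<open>G\<close> larger than \<open>R\<close>.
\<close>
lemma completely_reduced_iff_kernel:
  assumes f: "isoschematism \<XX> G C f"
  shows "completely_reduced \<XX> C \<longleftrightarrow> kernel G C f = reduction_kernel \<XX> G"
proof
  note f' = isoschematismD[OF f]
  note R = reduction_kernel_greatest[OF f'(1)] and RC = reduction_kernel_greatest[OF f'(2)]
  interpret f: group_hom G C f by (rule f'(6))
  let ?R = "reduction_kernel \<XX> G"
  have ker: "kernel G C f \<subseteq> ?R" by (rule R(2)[OF f'(8)])
  {
    assume cr: "completely_reduced \<XX> C"
    let ?p = "\<lambda>x. ?R #>\<^bsub>G\<^esub> x"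
    note p = projection_isoschematism[OF f'(1) R(1)]
    note p' = isoschematismD[OF p]
    have kp: "kernel G (G Mod ?R) ?p = ?R"
      using R(1) normal_projection(3) by (auto simp: reducing_def)
    obtain g where g: "group_hom C (G Mod ?R) g" "\<And>x. x \<in> carrier G \<Longrightarrow> g (f x) = ?p x"
      using epi_factor[OF f'(6,7) p'(6)] kp ker by metis
    have "g ` carrier C = (\<lambda>x. g (f x)) ` carrier G"
      using f'(7) by (simp add: image_image flip: f'(7))
    also have "\<dots> = carrier (G Mod ?R)"
      using g(2) p'(7) by (simp cong: image_cong)
    finally have "g \<in> epi C (G Mod ?R)"
      using g(1) epi_iff_group_hom[OF f'(4) p'(4)] by simp
    then have gf_epi: "g \<circ> f \<in> epi G (G Mod ?R)" using epi_compose[OF f'(5)] by blast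
    have "kernel G (G Mod ?R) (g \<circ> f) = kernel G (G Mod ?R) ?p"
      using g(2) by (auto simp: kernel_def)
    then have "isoschematism \<XX> G (G Mod ?R) (g \<circ> f)"
      using gf_epi f'(1) p'(2) kp R(1) by (simp add: isoschematism_iff_reducing)
    then have "isoschematism \<XX> C (G Mod ?R) g"
      by (rule isoschematism_comp_rev[OF f'(5) f'(2) \<open>g \<in> epi C (G Mod ?R)\<close>])
    then have "kernel C (G Mod ?R) g \<subseteq> {\<one>\<^bsub>C\<^esub>}"
      using RC(2)[OF isoschematismD(8)] cr by (simp add: completely_reduced_def)
    moreover have "f x \<in> kernel C (G Mod ?R) g" if x: "x \<in> ?R" for x
    proof -
      have "x \<in> kernel G (G Mod ?R) ?p" using x kp by simp
      then have "x \<in> carrier G" "g (f x) = \<one>\<^bsub>G Mod ?R\<^esub>"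
        using g(2) unfolding kernel_def by auto
      then show ?thesis unfolding kernel_def by simp
    qed
    moreover have "?R \<subseteq> carrier G"
      using R(1) subgroup.subset normal_imp_subgroup unfolding reducing_def by metis
    ultimately have "?R \<subseteq> kernel G C f" by (auto simp: kernel_def)
    then show "kernel G C f = ?R" using ker by blast
  }
  assume eq: "kernel G C f = ?R"
  let ?N = "reduction_kernel \<XX> C"
  have nN: "?N \<lhd> C" using RC(1) by (simp add: reducing_def)
  let ?p = "\<lambda>x. ?N #>\<^bsub>C\<^esub> x"
  have kp: "kernel C (C Mod ?N) ?p = ?N" by (rule normal_projection(3)[OF nN])
  have "isoschematism \<XX> G (C Mod ?N) (?p \<circ> f)"
    by (rule isoschematism_comp[OF f projection_isoschematism[OF f'(2) RC(1)]])
  then have k: "kernel G (C Mod ?N) (?p \<circ> f) \<subseteq> kernel G C f"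
    using R(2)[OF isoschematismD(8)] eq by simp
  have "y = \<one>\<^bsub>C\<^esub>" if y: "y \<in> ?N" for y
  proof -
    have yC: "y \<in> kernel C (C Mod ?N) ?p" using y kp by simp
    then have "y \<in> carrier C" unfolding kernel_def by blast
    then obtain x where x: "x \<in> carrier G" "y = f x" using f'(7) by blast
    then have "x \<in> kernel G (C Mod ?N) (?p \<circ> f)" using yC unfolding kernel_def by simp
    then show ?thesis using k x(2) unfolding kernel_def by blast
  qed
  moreover have "\<one>\<^bsub>C\<^esub> \<in> ?N"
    using subgroup.one_closed[OF normal_imp_subgroup[OF nN]] .
  ultimately show "completely_reduced \<XX> C"
    unfolding completely_reduced_def by blast
qed

lemma complete_reduction_iso:
  assumes f: "isoschematism \<XX> G C f" and C: "completely_reduced \<XX> C"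
  shows "complete_reduction \<XX> G \<cong> C"
  using group_hom.FactGroup_iso[OF isoschematismD(6,7)[OF f]] completely_reduced_iff_kernel[OF f] C
  by (simp add: complete_reduction_def)

lemma complete_reduction_isoschematism:
  assumes G: "finite_group G"
  shows "isoschematism \<XX> G (complete_reduction \<XX> G) (\<lambda>x. reduction_kernel \<XX> G #>\<^bsub>G\<^esub> x)"
    and "completely_reduced \<XX> (complete_reduction \<XX> G)"
proof -
  note R = reduction_kernel_greatest(1)[OF G]
  show iso: "isoschematism \<XX> G (complete_reduction \<XX> G) (\<lambda>x. reduction_kernel \<XX> G #>\<^bsub>G\<^esub> x)"
    using projection_isoschematism[OF G R] by (simp add: complete_reduction_def)
  show "completely_reduced \<XX> (complete_reduction \<XX> G)"
    unfolding completely_reduced_iff_kernel[OF iso]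
    using normal_projection(3) R by (auto simp: complete_reduction_def reducing_def)
qed

lemma group_complete_reduction: "finite_group G \<Longrightarrow> group (complete_reduction \<XX> G)"
  using isoschematismD(4)[OF complete_reduction_isoschematism(1)] .

lemma isoschematism_complete_reduction_iso:
  assumes f: "isoschematism \<XX> G D f"
  shows "complete_reduction \<XX> G \<cong> complete_reduction \<XX> D"
  using complete_reduction_iso[OF isoschematism_comp[OF f]]
    complete_reduction_isoschematism[OF isoschematismD(2)[OF f]] by blast

lemma isoschematism_onto_reduction:
  assumes G: "finite_group G" and C: "finite_group C" and iso: "complete_reduction \<XX> G \<cong> C"
  shows "\<exists>f. isoschematism \<XX> G C f \<and> completely_reduced \<XX> C"
proof -
  let ?R = "reduction_kernel \<XX> G" and ?Q = "complete_reduction \<XX> G"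
  let ?p = "\<lambda>x. ?R #>\<^bsub>G\<^esub> x"
  note p = isoschematismD[OF complete_reduction_isoschematism(1)[OF G]]
  obtain h where h: "h \<in> iso ?Q C" using iso by (auto simp: is_iso_def)
  have gC: "group C" using C by (simp add: finite_group_def)
  have "h \<in> epi ?Q C" using h by (simp add: iso_iff_mon_epi)
  then have epi: "h \<circ> ?p \<in> epi G C" using epi_compose[OF p(5)] by blast
  have "kernel ?Q C h = {\<one>\<^bsub>?Q\<^esub>}"
    using iso_kernel_image[OF p(4) gC] h by blast
  then have "kernel G C (h \<circ> ?p) = kernel G ?Q ?p"
    using group_hom.hom_closed[OF p(6)] by (auto simp: kernel_def set_eq_iff)
  also have "\<dots> = ?R"
    using reduction_kernel_greatest(1)[OF G] normal_projection(3)
    by (auto simp: complete_reduction_def reducing_def)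
  finally have ker: "kernel G C (h \<circ> ?p) = ?R" .
  then have "isoschematism \<XX> G C (h \<circ> ?p)"
    using G C epi reduction_kernel_greatest(1)[OF G] by (simp add: isoschematism_iff_reducing)
  then show ?thesis using completely_reduced_iff_kernel ker by blast
qed

lemma X_equiv_iff:
  assumes G: "finite_group G" and H: "finite_group H"
  shows "X_equiv \<XX> G H \<longleftrightarrow> complete_reduction \<XX> G \<cong> complete_reduction \<XX> H"
proof
  assume "X_equiv \<XX> G H"
  then obtain K :: "nat monoid" and f g where K: "finite_group K"
    and f: "isoschematism \<XX> G K f" and g: "isoschematism \<XX> H K g"
    by (auto simp: X_equiv_def)
  have "complete_reduction \<XX> G \<cong> complete_reduction \<XX> K"
    by (rule isoschematism_complete_reduction_iso[OF f])
  moreover have "complete_reduction \<XX> K \<cong> complete_reduction \<XX> H"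
    by (rule group.iso_sym[OF group_complete_reduction[OF H] isoschematism_complete_reduction_iso[OF g]])
  ultimately show "complete_reduction \<XX> G \<cong> complete_reduction \<XX> H" by (rule iso_trans)
next
  assume iso: "complete_reduction \<XX> G \<cong> complete_reduction \<XX> H"
  have "finite_group (complete_reduction \<XX> H)"
    by (rule isoschematismD(2)[OF complete_reduction_isoschematism(1)[OF H]])
  then obtain K :: "nat monoid" and h where K: "finite_group K" and h: "h \<in> iso (complete_reduction \<XX> H) K"
    by (rule nat_copy)
  have "complete_reduction \<XX> H \<cong> K" using h by (rule is_isoI)
  then show "X_equiv \<XX> G H"
    using isoschematism_onto_reduction[OF H K] isoschematism_onto_reduction[OF G K] iso iso_trans K
    unfolding X_equiv_def by blast
qed

lemma completely_reduced_iso_reduction: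
  assumes C: "finite_group C" and cr: "completely_reduced \<XX> C"
  shows "complete_reduction \<XX> C \<cong> C"
proof -
  have "group C" using C by (simp add: finite_group_def)
  then show ?thesis
    using group.trivial_factor_iso cr is_isoI
    by (fastforce simp: complete_reduction_def completely_reduced_def)
qed

text \<open>
  Choosing a representative in each coset embeds the cosets into the type of \<open>G\<close>, so that the
  complete reduction has a copy in the equivalence class of \<open>G\<close>.
\<close>
lemma complete_reduction_copy:
  fixes G :: "'a monoid"
  assumes G: "finite_group G"
  shows "\<exists>C :: 'a monoid. finite_group C \<and> complete_reduction \<XX> G \<cong> C"
proof -
  let ?R = "reduction_kernel \<XX> G" and ?Q = "complete_reduction \<XX> G"
  have gG: "group G" using G by (simp add: finite_group_def)
  have sR: "subgroup ?R G"
    using reduction_kernel_greatest(1)[OF G] normal_imp_subgroup by (auto simp: reducing_def)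
  have Q: "finite_group ?Q"
    by (rule isoschematismD(2)[OF complete_reduction_isoschematism(1)[OF G]])
  have "inj_on (\<lambda>c. SOME x. x \<in> c) (carrier ?Q)"
  proof (rule inj_onI)
    fix c d assume cd: "c \<in> carrier ?Q" "d \<in> carrier ?Q" "(SOME x. x \<in> c) = (SOME x. x \<in> d)"
    have r: "c \<in> rcosets\<^bsub>G\<^esub> ?R" "d \<in> rcosets\<^bsub>G\<^esub> ?R"
      using cd by (auto simp: complete_reduction_def FactGroup_def)
    then have "c \<noteq> {}" "d \<noteq> {}" using subgroup.rcosets_non_empty[OF sR] by blast+
    then have "c \<inter> d \<noteq> {}" using cd(3) by (metis disjoint_iff some_in_eq)
    then show "c = d"
      using group.rcos_disjoint[OF gG sR] r by (auto simp: pairwise_def disjnt_def)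
  qed
  then obtain C :: "'a monoid" where C: "group C" "(\<lambda>c. SOME x. x \<in> c) \<in> iso ?Q C"
    using isomorphic_copy[of ?Q] Q by (auto simp: finite_group_def)
  have iso: "?Q \<cong> C" using C(2) by (rule is_isoI)
  then have "finite_group C"
    using C(1) Q iso_finite by (auto simp: finite_group_def)
  then show ?thesis using iso by blast
qed

text \<open>
  Both kernels are the reduction kernel of \<open>G\<close>, and epimorphisms with equal kernels differ by an
  automorphism of the target.
\<close>
lemma same_morphism_completely_reduced:
  assumes f: "isoschematism \<XX> G C f" and g: "isoschematism \<XX> G C g" and C: "completely_reduced \<XX> C"
  shows "same_morphism G C f g"
proof -
  note f' = isoschematismD[OF f] and g' = isoschematismD[OF g]
  have ker: "kernel G C f = kernel G C g"
    using completely_reduced_iff_kernel[OF f] completely_reduced_iff_kernel[OF g] C by simp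
  obtain b where b: "group_hom C C b" "\<And>x. x \<in> carrier G \<Longrightarrow> b (f x) = g x"
    using epi_factor[OF f'(6,7) g'(6)] ker by blast
  have "b ` carrier C = (\<lambda>x. b (f x)) ` carrier G"
    by (simp add: image_image flip: f'(7))
  also have "\<dots> = carrier C"
    using b(2) g'(7) by (simp cong: image_cong)
  finally have surj: "b ` carrier C = carrier C" .
  moreover have "finite (carrier C)" using f'(2) by (simp add: finite_group_def)
  ultimately have "inj_on b (carrier C)" by (simp add: endo_inj_surj eq_card_imp_inj_on)
  then have "b \<in> iso C C"
    using surj b(1) by (simp add: iso_iff group_hom_def group_hom_axioms_def)
  then show ?thesis
    unfolding same_morphism_def
    by (intro bexI[of _ "\<lambda>x. x"] bexI[of _ b]) (auto simp: b(2) iso_set_refl)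
qed

end

theorem mainTheorem6:
  fixes \<XX> :: "nat monoid set"
  assumes "complete_class \<XX>"
  shows
    "(\<forall>(G\<^sub>1 :: 'a monoid) (G\<^sub>2 :: 'b monoid). finite_group G\<^sub>1 \<and> finite_group G\<^sub>2 \<longrightarrow>
        (X_equiv \<XX> G\<^sub>1 G\<^sub>2 \<longleftrightarrow> complete_reduction \<XX> G\<^sub>1 \<cong> complete_reduction \<XX> G\<^sub>2)) \<and>
     equiv {G :: 'a monoid. finite_group G} (X_equiv_rel \<XX>) \<and>
     (\<forall>E \<in> {G :: 'a monoid. finite_group G} // X_equiv_rel \<XX>.
        (\<exists>C\<in>E. completely_reduced \<XX> C) \<and>
        (\<forall>C\<in>E. \<forall>C'\<in>E. completely_reduced \<XX> C \<and> completely_reduced \<XX> C' \<longrightarrow> C \<cong> C') \<and>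
        (\<forall>C\<in>E. completely_reduced \<XX> C \<longrightarrow> universally_attracting \<XX> E C))"
proof (intro conjI ballI allI impI)
  interpret complete_group_class \<XX> by unfold_locales (rule assms)
  let ?red = "complete_reduction \<XX>"
  show "X_equiv \<XX> G\<^sub>1 G\<^sub>2 \<longleftrightarrow> ?red G\<^sub>1 \<cong> ?red G\<^sub>2" if "finite_group G\<^sub>1 \<and> finite_group G\<^sub>2"
    for G\<^sub>1 :: "'a monoid" and G\<^sub>2 :: "'b monoid"
    using that X_equiv_iff by blast
  have rel: "X_equiv_rel \<XX> =
      {(G, H). finite_group G \<and> finite_group H \<and> ?red G \<cong> ?red (H :: 'a monoid)}"
    unfolding X_equiv_rel_def using X_equiv_iff by blast
  note sym = group.iso_sym[OF group_complete_reduction]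
  show "equiv {G :: 'a monoid. finite_group G} (X_equiv_rel \<XX>)"
    unfolding rel
    by (intro equivI refl_onI symI transI) (auto intro: sym iso_trans)
  fix E assume "E \<in> {G :: 'a monoid. finite_group G} // X_equiv_rel \<XX>"
  then obtain G :: "'a monoid" where G: "finite_group G" and E: "E = X_equiv_rel \<XX> `` {G}"
    by (auto elim: quotientE)
  have E_iff: "H \<in> E \<longleftrightarrow> finite_group H \<and> ?red G \<cong> ?red H" for H
    using G by (simp add: E rel)
  have red_iso: "?red H \<cong> C" if "H \<in> E" "C \<in> E" "completely_reduced \<XX> C" for H C
  proof -
    have "?red H \<cong> ?red C"
      using that sym[OF G] iso_trans unfolding E_iff by blast
    then show ?thesis
      using completely_reduced_iso_reduction that iso_trans unfolding E_iff by blast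
  qed
  obtain C :: "'a monoid" where C: "finite_group C" "?red G \<cong> C"
    using complete_reduction_copy[OF G] by blast
  then obtain f where f: "isoschematism \<XX> G C f" "completely_reduced \<XX> C"
    using isoschematism_onto_reduction[OF G] by blast
  have "C \<in> E"
    using C(1) isoschematism_complete_reduction_iso[OF f(1)] by (simp add: E_iff)
  then show "\<exists>C\<in>E. completely_reduced \<XX> C"
    using f(2) by blast
  show "C \<cong> C'"
    if "C \<in> E" "C' \<in> E" "completely_reduced \<XX> C \<and> completely_reduced \<XX> C'" for C C'
  proof -
    have "C \<cong> ?red C"
      using group.iso_sym[OF group_complete_reduction red_iso[of C C]] that unfolding E_iff by blast
    then show ?thesis using red_iso[of C C'] that iso_trans by blast
  qed
  show "universally_attracting \<XX> E C" if C: "C \<in> E" "completely_reduced \<XX> C" for C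
    unfolding universally_attracting_def
  proof (intro conjI ballI)
    fix H assume H: "H \<in> E"
    then obtain f where "isoschematism \<XX> H C f"
      using isoschematism_onto_reduction[OF _ _ red_iso[OF H C]] C(1) unfolding E_iff by blast
    then show "\<exists>f. isoschematism \<XX> H C f \<and> (\<forall>g. isoschematism \<XX> H C g \<longrightarrow> same_morphism H C f g)"
      using same_morphism_completely_reduced C(2) by blast
  qed (rule C(1))
qed

end
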